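(* Let $\mu$ be any positive probability measure on $\mathbb{R}^m$. Then $$\dim_H(\mu)\le \dim_T(\mu)\le \max\{\dim_M(\mu),1\}.$$ Moreover, $$\dim_H(\mu)\le \dim_T(\mu)\le \dim_U(\mu).$$
   Context: **Atomic measures.** A (finite) atomic measure on $\mathbb{R}^m$ is $\mathbf{a}=\sum_{i=1}^k m_i\delta_{x_i}$ with distinct $x_i\in\mathbb{R}^m$ and $m_i>0$; its mass is $\|\mathbf{a}\|=\sum_i m_i$. **Transport paths.** For atomic measures $\mathbf{a}=\sum_{i=1}^k m_i\delta_{x_i}$, $\mathbf{b}=\sum_{j=1}^\ell n_j\delta_{y_j}$ of equal mass, a transport path from $\mathbf{a}$ to $\mathbf{b}$ is a finite weighted directed graph $G$ with vertex set $V(G)\subset\mathbb{R}^m$ containing all $x_i,y_j$, directed edge set $E(G)$ (straight segments) and weights $w:E(G)\to(0,\infty)$ such that at each vertex $v$ $$\sum_{e^-=v}w(e)=\sum_{e^+=v}w(e)+(m_i\text{ if }v=x_i)+(-n_j\text{ if }v=y_j),$$ where $e^-,e^+$ are the start and end points of $e$ (both extra terms occur if $v=x_i=y_j$). Let $Path(\mathbf{a},\mathbf{b})$ be the set of these. When $\alpha<0$ the following convention is adopted: whenever a directed chain of edges of positive length starts and ends at the same point $v$, its end vertex is viewed as a different copy of $v$, and the balance equation must hold separately at each copy. Precisely, for $\alpha<0$: $V(G)$ is a finite abstract set with a position map to $\mathbb{R}^m$, edges join vertices with distinct positions, $G$ has no directed cycles, each $x_i$ is assigned a single vertex $s_i$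 at position $x_i$ and each $y_j$ a single vertex $t_j$ at position $y_j$ ($s_i=t_j$ is allowed if $x_i=y_j$), and the balance equation holds at each vertex with extra term $+m_i$ at $s_i$ and $-n_j$ at $t_j$. In particular $w(e)\le\|\mathbf{a}\|$ for every edge. For $\alpha\le1$, $\mathbf{M}_\alpha(G)=\sum_{e\in E(G)}w(e)^\alpha\,\mathrm{length}(e)$. **$\mathcal{D}_\alpha$.** Let $\alpha<1$. A sequence $\mathbf{a}_k=\sum_{i=1}^{N_k}m_i^{(k)}\delta_{x_i^{(k)}}$ of atomic measures of equal total mass is a $d_\alpha$-admissible Cauchy sequence if for every $\epsilon>0$ there is $N$ such that for all $n>k\ge N$ there are a partition $\mathbf{a}_n=\sum_{i=1}^{N_k}\mathbf{a}_{n,i}^{(k)}$ into disjoint atomic measures (pairwise disjoint supports) with $\|\mathbf{a}_{n,i}^{(k)}\|=m_i^{(k)}$, and paths $G_{n,i}^k\in Path(m_i^{(k)}\delta_{x_i^{(k)}},\mathbf{a}_{n,i}^{(k)})$ with $\sum_{i=1}^{N_k}\mathbf{M}_\alpha(G_{n,i}^k)\le\epsilon$. $\mathcal{D}_\alpha(\mathbb{R}^m)$ is the set of probability measures $\mu$ on $\mathbb{R}^m$ represented by a $d_\alpha$-admissible Cauchy sequence of atomic probability measures (i.e. the sequence converges weakly to $\mu$). **Transport and Hausdorff dimensions.** $\dim_T(\mu)=\inf_{\alpha<1}\{\frac1{1-\alpha}:\mu\in\mathcal{D}_\alpha(\mathbb{R}^m)\}$. $\dim_H(\mu)=\inf\{\dim_H(A):\mu(\mathbb{R}^m\setminus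 A)=0\}$, with $\dim_H(A)$ the Hausdorff dimension of $A$. **Nested collections.** A nested collection is a family $\mathcal{F}=\{Q_i^n:1\le i\le N_n,\ n\ge1\}$ of Borel subsets of $\mathbb{R}^m$ ($N_n<\infty$) such that: (1) $C_1\sigma^n\le \mathrm{diam}(Q_i^n)\le C_2\sigma^n$ for some constants $C_2\ge C_1>0$, $\sigma\in(0,1)$; (2) for all $k,l,i,j$ with $l\le k$, either $Q_i^k\cap Q_j^l=\emptyset$ or $Q_i^k\subseteq Q_j^l$; (3) each $Q_j^{n+1}$ is contained in exactly one $Q_i^n$ (its parent); (4) each $Q_i^n$ contains at least one $Q_j^{n+1}$ (a child). $Q_i^n$ is called a cube of generation $n$. Two different cubes of the same generation with the same parent are brothers. Its Minkowski dimension is $\dim_M(\mathcal{F})=\lim_{n\to\infty}\frac{\log N_n}{\log(1/\sigma^n)}$, provided the limit exists. A Radon measure $\mu$ is concentrated on $\mathcal{F}$ if $\mu(\mathbb{R}^m\setminus\bigcup_{i=1}^{N_n}Q_i^n)=0$ for each $n$. It is evenly concentrated on $\mathcal{F}$ if it is concentrated on $\mathcal{F}$ and there is a constant $\lambda>0$ such that each $Q_i^n$ either has no brothers or satisfies $\mu(Q_i^n)\ge\lambda/N_n$. $\dim_M(\mu)$ is the infimum of $\dim_M(\mathcal{F})$ over all nested collections $\mathcal{F}$ on which $\mu$ is concentrated; $\dim_U(\mu)$ is the infimum of $\dim_M(\mathcal{F})$ over all nested collections on which $\mu$ is evenly concentrated. Infima over the empty set are $+\infty$. *)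

theory Defs
  imports "HOL-Probability.Probability"
begin

section \<open>Atomic measures\<close>

text \<open>
  The atomic measure with masses \<open>m\<^sub>i > 0\<close> at the distinct points \<open>x\<^sub>i\<close> is represented by the function
  that maps each \<open>x\<^sub>i\<close> to \<open>m\<^sub>i\<close> and every other point to 0. Families indexed by
  \<open>i\<close> become families indexed by the points in \<^term>\<open>atoms a\<close>.
\<close>

definition atoms :: "('a \<Rightarrow> real) \<Rightarrow> 'a set" where
  "atoms a = {x. a x \<noteq> 0}"

definition atomic :: "('a \<Rightarrow> real) \<Rightarrow> bool" where
  "atomic a \<longleftrightarrow> finite (atoms a) \<and> (\<forall>x\<in>atoms a. a x > 0)"

definition mass :: "('a \<Rightarrow> real) \<Rightarrow> real" where
  "mass a = (\<Sum>x\<in>atoms a. a x)"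

definition point_mass :: "real \<Rightarrow> 'a \<Rightarrow> 'a \<Rightarrow> real" where
  "point_mass c x = (\<lambda>z. if z = x then c else 0)"

definition atomic_measure :: "('a::topological_space \<Rightarrow> real) \<Rightarrow> 'a measure" where
  "atomic_measure a = distr (density (count_space UNIV) (\<lambda>x. ennreal (a x))) borel (\<lambda>x. x)"


section \<open>Transport paths\<close>

text \<open>
  Vertices are abstract (here: natural numbers, which is no restriction since graphs are finite) and
  carry a position. For \<open>\<alpha> \<ge> 0\<close> the vertices are points of the space, that is, the position map is
  injective on them; then the maps \<open>s\<close> and \<open>t\<close> below are determined by the positions.
\<close>

record 'a transport_graph =
  vertices :: "nat set"
  edges :: "(nat \<times> nat) set"
  weight :: "nat \<times> nat \<Rightarrow> real"
  pos :: "nat \<Rightarrow> 'a"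

definition Path :: "real \<Rightarrow> ('a \<Rightarrow> real) \<Rightarrow> ('a \<Rightarrow> real) \<Rightarrow> 'a transport_graph set" where
  "Path \<alpha> a b = {G.
     finite (vertices G) \<and>
     edges G \<subseteq> vertices G \<times> vertices G \<and>
     (\<forall>e\<in>edges G. weight G e > 0) \<and>
     (if \<alpha> < 0
      then acyclic (edges G) \<and> (\<forall>e\<in>edges G. pos G (fst e) \<noteq> pos G (snd e))
      else inj_on (pos G) (vertices G)) \<and>
     (\<exists>s t.
        (\<forall>x\<in>atoms a. s x \<in> vertices G \<and> pos G (s x) = x) \<and>
        (\<forall>y\<in>atoms b. t y \<in> vertices G \<and> pos G (t y) = y) \<and>
        (\<forall>v\<in>vertices G.
           (\<Sum>e | e \<in> edges G \<and> fst e = v. weight G e) =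
           (\<Sum>e | e \<in> edges G \<and> snd e = v. weight G e)
           + (\<Sum>x | x \<in> atoms a \<and> s x = v. a x)
           - (\<Sum>y | y \<in> atoms b \<and> t y = v. b y)))}"

definition M_cost :: "real \<Rightarrow> 'a::metric_space transport_graph \<Rightarrow> real" where
  "M_cost \<alpha> G = (\<Sum>e\<in>edges G. weight G e powr \<alpha> * dist (pos G (fst e)) (pos G (snd e)))"


section \<open>Admissible Cauchy sequences and the transport dimension\<close>

definition admissible_Cauchy :: "real \<Rightarrow> (nat \<Rightarrow> 'a::metric_space \<Rightarrow> real) \<Rightarrow> bool" where
  "admissible_Cauchy \<alpha> a \<longleftrightarrow>
     (\<forall>k. atomic (a k)) \<and>
     (\<forall>k l. mass (a k) = mass (a l)) \<and>
     (\<forall>\<epsilon>>0. \<exists>N. \<forall>k\<ge>N. \<forall>n>k.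
        \<exists>(p :: 'a \<Rightarrow> 'a \<Rightarrow> real) (G :: 'a \<Rightarrow> 'a transport_graph).
          (\<forall>x\<in>atoms (a k). atomic (p x) \<and> mass (p x) = a k x) \<and>
          disjoint_family_on (\<lambda>x. atoms (p x)) (atoms (a k)) \<and>
          (\<forall>z. a n z = (\<Sum>x\<in>atoms (a k). p x z)) \<and>
          (\<forall>x\<in>atoms (a k). G x \<in> Path \<alpha> (point_mass (a k x) x) (p x)) \<and>
          (\<Sum>x\<in>atoms (a k). M_cost \<alpha> (G x)) \<le> \<epsilon>)"

definition weakly_converges :: "(nat \<Rightarrow> 'a::topological_space measure) \<Rightarrow> 'a measure \<Rightarrow> bool" where
  "weakly_converges M \<mu> \<longleftrightarrow>
     (\<forall>f :: 'a \<Rightarrow> real. continuous_on UNIV f \<and> bounded (range f) \<longrightarrow>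
        (\<lambda>n. \<integral>x. f x \<partial>M n) \<longlonglongrightarrow> (\<integral>x. f x \<partial>\<mu>))"

definition D_class :: "real \<Rightarrow> 'a::metric_space measure set" where
  "D_class \<alpha> = {\<mu>. prob_space \<mu> \<and> sets \<mu> = sets borel \<and>
     (\<exists>a. admissible_Cauchy \<alpha> a \<and> (\<forall>k. mass (a k) = 1) \<and>
          weakly_converges (\<lambda>k. atomic_measure (a k)) \<mu>)}"

definition dim_T :: "'a::metric_space measure \<Rightarrow> ereal" where
  "dim_T \<mu> = Inf {ereal (1 / (1 - \<alpha>)) |\<alpha>. \<alpha> < 1 \<and> \<mu> \<in> D_class \<alpha>}"


section \<open>Hausdorff dimension\<close>

text \<open>
  The case \<open>s = 0\<close> is separate because \<^term>\<open>0 powr 0 = (0::real)\<close>. Boundedness of the covering sets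
  must be required explicitly since \<^const>\<open>diameter\<close> is unspecified on unbounded sets.
\<close>

definition diam_power :: "real \<Rightarrow> 'a::metric_space set \<Rightarrow> ennreal" where
  "diam_power s U = (if U = {} then 0 else if s = 0 then 1 else ennreal (diameter U powr s))"

definition Hausdorff_premeasure :: "real \<Rightarrow> real \<Rightarrow> 'a::metric_space set \<Rightarrow> ennreal" where
  "Hausdorff_premeasure \<delta> s A =
     Inf {(\<Sum>n. diam_power s (U n)) |U :: nat \<Rightarrow> 'a set.
            A \<subseteq> (\<Union>n. U n) \<and> (\<forall>n. bounded (U n) \<and> diameter (U n) \<le> \<delta>)}"

definition Hausdorff_measure :: "real \<Rightarrow> 'a::metric_space set \<Rightarrow> ennreal" where
  "Hausdorff_measure s A = (SUP \<delta>\<in>{0<..}. Hausdorff_premeasure \<delta> s A)"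

definition Hausdorff_dim :: "'a::metric_space set \<Rightarrow> ereal" where
  "Hausdorff_dim A = Inf {ereal s |s. s \<ge> 0 \<and> Hausdorff_measure s A = 0}"

text \<open>
  The restriction to measurable sets is needed because \<^const>\<open>emeasure\<close> vanishes on non-measurable
  sets; it does not change the infimum, as a set with null complement contains a measurable one.
\<close>

definition dim_H :: "'a::metric_space measure \<Rightarrow> ereal" where
  "dim_H \<mu> = Inf {Hausdorff_dim A |A. A \<in> sets \<mu> \<and> emeasure \<mu> (space \<mu> - A) = 0}"


section \<open>Nested collections\<close>

text \<open>
  A collection is given by the numbers \<open>N n\<close> and the cubes \<open>Q n i\<close> for \<open>n \<ge> 1\<close> and \<open>1 \<le> i \<le> N n\<close>;
  other values are irrelevant.
\<close>

definition nested_collection ::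
    "real \<Rightarrow> (nat \<Rightarrow> nat) \<Rightarrow> (nat \<Rightarrow> nat \<Rightarrow> 'a::metric_space set) \<Rightarrow> bool" where
  "nested_collection \<sigma> N Q \<longleftrightarrow>
     0 < \<sigma> \<and> \<sigma> < 1 \<and>
     (\<forall>n\<ge>1. \<forall>i\<in>{1..N n}. Q n i \<in> sets borel) \<and>
     (\<exists>C1 C2. 0 < C1 \<and> C1 \<le> C2 \<and>
        (\<forall>n\<ge>1. \<forall>i\<in>{1..N n}. bounded (Q n i) \<and>
           C1 * \<sigma> ^ n \<le> diameter (Q n i) \<and> diameter (Q n i) \<le> C2 * \<sigma> ^ n)) \<and>
     (\<forall>l\<ge>1. \<forall>k\<ge>l. \<forall>i\<in>{1..N k}. \<forall>j\<in>{1..N l}. Q k i \<inter> Q l j = {} \<or> Q k i \<subseteq> Q l j) \<and>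
     (\<forall>n\<ge>1. \<forall>j\<in>{1..N (Suc n)}. \<exists>!i. i \<in> {1..N n} \<and> Q (Suc n) j \<subseteq> Q n i) \<and>
     (\<forall>n\<ge>1. \<forall>i\<in>{1..N n}. \<exists>j\<in>{1..N (Suc n)}. Q (Suc n) j \<subseteq> Q n i)"

definition has_Minkowski_dim :: "real \<Rightarrow> (nat \<Rightarrow> nat) \<Rightarrow> real \<Rightarrow> bool" where
  "has_Minkowski_dim \<sigma> N d \<longleftrightarrow> (\<lambda>n. ln (real (N n)) / ln (1 / \<sigma> ^ n)) \<longlonglongrightarrow> d"

text \<open>Cubes of generation 1 have no parent and hence no brothers.\<close>

definition brothers :: "(nat \<Rightarrow> nat) \<Rightarrow> (nat \<Rightarrow> nat \<Rightarrow> 'a set) \<Rightarrow> nat \<Rightarrow> nat \<Rightarrow> nat \<Rightarrow> bool" where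
  "brothers N Q n i j \<longleftrightarrow>
     n \<ge> 2 \<and> i \<in> {1..N n} \<and> j \<in> {1..N n} \<and> i \<noteq> j \<and>
     (\<exists>p\<in>{1..N (n - 1)}. Q n i \<subseteq> Q (n - 1) p \<and> Q n j \<subseteq> Q (n - 1) p)"

definition concentrated_on ::
    "'a::metric_space measure \<Rightarrow> (nat \<Rightarrow> nat) \<Rightarrow> (nat \<Rightarrow> nat \<Rightarrow> 'a set) \<Rightarrow> bool" where
  "concentrated_on \<mu> N Q \<longleftrightarrow> (\<forall>n\<ge>1. emeasure \<mu> (space \<mu> - (\<Union>i\<in>{1..N n}. Q n i)) = 0)"

definition evenly_concentrated_on ::
    "'a::metric_space measure \<Rightarrow> (nat \<Rightarrow> nat) \<Rightarrow> (nat \<Rightarrow> nat \<Rightarrow> 'a set) \<Rightarrow> bool" where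
  "evenly_concentrated_on \<mu> N Q \<longleftrightarrow>
     concentrated_on \<mu> N Q \<and>
     (\<exists>c>0. \<forall>n\<ge>1. \<forall>i\<in>{1..N n}.
        (\<nexists>j. brothers N Q n i j) \<or> measure \<mu> (Q n i) \<ge> c / real (N n))"

definition dim_M :: "'a::metric_space measure \<Rightarrow> ereal" where
  "dim_M \<mu> = Inf {ereal d |d. \<exists>\<sigma> N Q.
     nested_collection \<sigma> N Q \<and> concentrated_on \<mu> N Q \<and> has_Minkowski_dim \<sigma> N d}"

definition dim_U :: "'a::metric_space measure \<Rightarrow> ereal" where
  "dim_U \<mu> = Inf {ereal d |d. \<exists>\<sigma> N Q.
     nested_collection \<sigma> N Q \<and> evenly_concentrated_on \<mu> N Q \<and> has_Minkowski_dim \<sigma> N d}"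

end

theory Submission
  imports Defs
begin

text \<open>
  Lower bound: a path that moves mass \<open>T\<close> out of a ball of radius \<open>r\<close> around a source of mass
  \<open>m\<close> costs at least \<open>m powr (\<alpha> - 1) * T * r\<close>. With radii \<open>L * m powr (1 - \<alpha>)\<close> around
  the atoms of an approximating measure, the balls carry all but \<open>L\<close> of \<open>\<mu>\<close> once the cost is at
  most \<open>L\<^sup>2\<close>, while their \<open>1 / (1 - \<alpha>)\<close>-th powers add up to \<open>L powr (1 / (1 - \<alpha>))\<close>.
  A limsup set of such unions has full measure and vanishing Hausdorff measure.

  Upper bounds: concentrate the mass of each cube in one of its points and transport generation by
  generation. If the point of a cube is inherited by the child that contains it, only cubes with a
  brother are fed at a positive cost. Level \<open>n\<close> then costs a multiple of
  \<open>N n powr (1 - \<alpha>) * \<sigma> ^ n\<close>, by concavity for \<open>\<alpha> \<ge> 0\<close> and by even concentration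
  for \<open>\<alpha> < 0\<close>, and this is summable when \<open>(1 - \<alpha>) * d < 1\<close>.
\<close>


section \<open>Hausdorff dimension and transport dimension\<close>

lemma sum_fibers:
  fixes f :: "'b \<Rightarrow> 'c::comm_monoid_add"
  assumes "finite A" "finite S"
  shows "(\<Sum>v\<in>S. \<Sum>e | e \<in> A \<and> h e = v. f e) = (\<Sum>e | e \<in> A \<and> h e \<in> S. f e)"
proof -
  have "(\<Sum>v\<in>S. \<Sum>e | e \<in> {e \<in> A. h e \<in> S} \<and> h e = v. f e) = (\<Sum>e | e \<in> A \<and> h e \<in> S. f e)"
    using assms by (intro sum.group) auto
  moreover have "(\<Sum>e | e \<in> {e \<in> A. h e \<in> S} \<and> h e = v. f e) = (\<Sum>e | e \<in> A \<and> h e = v. f e)"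
    if "v \<in> S" for v
    using that by (intro sum.cong) auto
  ultimately show ?thesis by simp
qed

text \<open>Sum the vertex balance over \<open>S\<close>: edges with both ends in \<open>S\<close>
  occur once as outgoing and once as incoming, so they cancel and only edges crossing the boundary
  survive.\<close>

lemma cut_balance:
  fixes w :: "'v \<times> 'v \<Rightarrow> real"
  assumes "finite E" "finite A" "finite B" "finite S"
    and balance: "\<And>v. v \<in> S \<Longrightarrow>
           (\<Sum>e | e \<in> E \<and> fst e = v. w e) = (\<Sum>e | e \<in> E \<and> snd e = v. w e)
           + (\<Sum>x | x \<in> A \<and> s x = v. a x) - (\<Sum>y | y \<in> B \<and> t y = v. b y)"
  shows "(\<Sum>e | e \<in> E \<and> fst e \<in> S \<and> snd e \<notin> S. w e) =
         (\<Sum>e | e \<in> E \<and> fst e \<notin> S \<and> snd e \<in> S. w e)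
         + (\<Sum>x | x \<in> A \<and> s x \<in> S. a x) - (\<Sum>y | y \<in> B \<and> t y \<in> S. b y)"
proof -
  have "(\<Sum>v\<in>S. \<Sum>e | e \<in> E \<and> fst e = v. w e) = (\<Sum>v\<in>S. \<Sum>e | e \<in> E \<and> snd e = v. w e)
           + (\<Sum>v\<in>S. \<Sum>x | x \<in> A \<and> s x = v. a x) - (\<Sum>v\<in>S. \<Sum>y | y \<in> B \<and> t y = v. b y)"
    using balance by (simp add: sum.distrib sum_subtractf)
  then have *: "(\<Sum>e | e \<in> E \<and> fst e \<in> S. w e) = (\<Sum>e | e \<in> E \<and> snd e \<in> S. w e)
           + (\<Sum>x | x \<in> A \<and> s x \<in> S. a x) - (\<Sum>y | y \<in> B \<and> t y \<in> S. b y)"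
    using assms(1-4) by (simp add: sum_fibers)
  let ?I = "{e \<in> E. fst e \<in> S \<and> snd e \<in> S}"
  have "{e \<in> E. fst e \<in> S} = ?I \<union> {e \<in> E. fst e \<in> S \<and> snd e \<notin> S}" by auto
  then have 1: "(\<Sum>e | e \<in> E \<and> fst e \<in> S. w e) = sum w ?I + (\<Sum>e | e \<in> E \<and> fst e \<in> S \<and> snd e \<notin> S. w e)"
    using \<open>finite E\<close> by (simp add: sum.union_disjoint[symmetric] disjoint_iff)
  have "{e \<in> E. snd e \<in> S} = ?I \<union> {e \<in> E. fst e \<notin> S \<and> snd e \<in> S}" by auto
  then have 2: "(\<Sum>e | e \<in> E \<and> snd e \<in> S. w e) = sum w ?I + (\<Sum>e | e \<in> E \<and> fst e \<notin> S \<and> snd e \<in> S. w e)"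
    using \<open>finite E\<close> by (simp add: sum.union_disjoint[symmetric] disjoint_iff)
  show ?thesis using * 1 2 by simp
qed

lemma atoms_point_mass: "c \<noteq> 0 \<Longrightarrow> atoms (point_mass c x) = {x}"
  by (auto simp: atoms_def point_mass_def)

lemma atomic_nonneg: "atomic a \<Longrightarrow> 0 \<le> a x"
  by (cases "x \<in> atoms a") (auto simp: atomic_def atoms_def less_imp_le)

lemma atomic_finite: "atomic a \<Longrightarrow> finite (atoms a)"
  by (auto simp: atomic_def)

text \<open>The cut is the set of ancestors of the start of the edge.\<close>

lemma acyclic_weight_le:
  assumes G: "G \<in> Path \<alpha> (point_mass m x) p" and "\<alpha> < 0" "m > 0" "atomic p" and e: "e \<in> edges G"
  shows "weight G e \<le> m"
proof -
  define E where "E = edges G"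
  obtain s t where fin: "finite (vertices G)" and EV: "E \<subseteq> vertices G \<times> vertices G"
    and wpos: "\<forall>e\<in>E. weight G e > 0" and acyc: "acyclic E"
    and bal: "\<forall>v\<in>vertices G.
           (\<Sum>e | e \<in> E \<and> fst e = v. weight G e) =
           (\<Sum>e | e \<in> E \<and> snd e = v. weight G e)
           + (\<Sum>y | y \<in> atoms (point_mass m x) \<and> s y = v. point_mass m x y)
           - (\<Sum>y | y \<in> atoms p \<and> t y = v. p y)"
    using G \<open>\<alpha> < 0\<close> unfolding Path_def E_def by auto
  have finE: "finite E" using fin EV by (meson finite_SigmaI finite_subset)
  obtain u v where uv: "e = (u, v)" by force
  define S where "S = {z \<in> vertices G. (z, u) \<in> E\<^sup>*}"
  have "finite S" using fin by (simp add: S_def)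
  have balS: "(\<Sum>e | e \<in> E \<and> fst e = v. weight G e) =
           (\<Sum>e | e \<in> E \<and> snd e = v. weight G e)
           + (\<Sum>y | y \<in> atoms (point_mass m x) \<and> s y = v. point_mass m x y)
           - (\<Sum>y | y \<in> atoms p \<and> t y = v. p y)" if "v \<in> S" for v
    using bal that by (auto simp: S_def)
  have cut: "(\<Sum>e | e \<in> E \<and> fst e \<in> S \<and> snd e \<notin> S. weight G e) =
         (\<Sum>e | e \<in> E \<and> fst e \<notin> S \<and> snd e \<in> S. weight G e)
         + (\<Sum>y | y \<in> atoms (point_mass m x) \<and> s y \<in> S. point_mass m x y)
         - (\<Sum>y | y \<in> atoms p \<and> t y \<in> S. p y)"
    by (rule cut_balance[OF finE _ _ \<open>finite S\<close> balS])
       (use assms in \<open>auto simp: atoms_point_mass atomic_finite\<close>)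
  \<comment> \<open>An edge that ends at an ancestor of \<open>u\<close> also starts at one, so
    nothing flows into \<open>S\<close> and its outflow is at most the source mass
    \<open>m\<close>.\<close>
  have no_in: "{e. e \<in> E \<and> fst e \<notin> S \<and> snd e \<in> S} = {}"
    using EV by (auto simp: S_def intro: converse_rtrancl_into_rtrancl)
  have "(\<Sum>y | y \<in> atoms (point_mass m x) \<and> s y \<in> S. point_mass m x y) \<le>
        (\<Sum>y \<in> {x}. point_mass m x y)"
    using \<open>m > 0\<close> atoms_point_mass[of m x] by (intro sum_mono2) (auto simp: point_mass_def)
  also have "\<dots> = m" by (simp add: point_mass_def)
  finally have src: "(\<Sum>y | y \<in> atoms (point_mass m x) \<and> s y \<in> S. point_mass m x y) \<le> m" .
  have snk: "(\<Sum>y | y \<in> atoms p \<and> t y \<in> S. p y) \<ge> 0"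
    using \<open>atomic p\<close> by (intro sum_nonneg) (auto simp: atomic_nonneg)
  have "v \<notin> S"
  proof
    assume "v \<in> S"
    then have "(v, u) \<in> E\<^sup>*" by (simp add: S_def)
    moreover have "(u, v) \<in> E" using e uv by (simp add: E_def)
    ultimately have "(u, u) \<in> E\<^sup>+" by (metis rtrancl_into_trancl2) 
    then show False using acyc by (auto simp: acyclic_def)
  qed
  moreover have "u \<in> S" using e uv EV by (auto simp: S_def E_def)
  ultimately have "weight G e \<le> (\<Sum>e | e \<in> E \<and> fst e \<in> S \<and> snd e \<notin> S. weight G e)"
    using finE e uv wpos by (intro member_le_sum) (auto simp: E_def less_imp_le)
  then show ?thesis using cut no_in src snk by simp
qed

text \<open>The \<open>max\<close> covers edges that point towards the centre: their interval is
  empty and they contribute nothing.\<close>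

lemma integral_indicator_Ioc:
  fixes a b :: real
  shows "integrable lborel (indicator {a<..b} :: real \<Rightarrow> real)"
    and "(\<integral>x. indicator {a<..b} x \<partial>lborel) = max 0 (b - a)"
  by (cases "a \<le> b"; auto simp: max_def measure_def)+

text \<open>
  Integrating over \<open>\<rho>\<close> the flux through the spheres of radius \<open>\<rho>\<close> around the source bounds the cost from
  below. Through each sphere, \<open>w powr \<alpha> \<ge> m powr (\<alpha> - 1) * w\<close> for edges of weight at most
  \<open>m\<close>, while heavier edges (they exist only for \<open>\<alpha> \<ge> 0\<close>, on cycles) suffice on their own.
\<close>

lemma mass_moved_le_cost:
  fixes p :: "'a::metric_space \<Rightarrow> real"
  assumes G: "G \<in> Path \<alpha> (point_mass m x) p" and "\<alpha> < 1" "m > 0" "atomic p" "mass p = m" "r > 0"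
  shows "r * (\<Sum>z | z \<in> atoms p \<and> dist x z \<ge> r. p z) \<le> m powr (1 - \<alpha>) * M_cost \<alpha> G"
proof -
  define E where "E = edges G"
  define T where "T = (\<Sum>z | z \<in> atoms p \<and> dist x z \<ge> r. p z)"
  define d where "d v = dist x (pos G v)" for v
  obtain s t where fin: "finite (vertices G)" and EV: "E \<subseteq> vertices G \<times> vertices G"
    and wpos: "\<forall>e\<in>E. weight G e > 0"
    and s: "s x \<in> vertices G" "pos G (s x) = x"
    and t: "\<forall>y\<in>atoms p. t y \<in> vertices G \<and> pos G (t y) = y"
    and bal: "\<forall>v\<in>vertices G.
           (\<Sum>e | e \<in> E \<and> fst e = v. weight G e) =
           (\<Sum>e | e \<in> E \<and> snd e = v. weight G e)
           + (\<Sum>y | y \<in> atoms (point_mass m x) \<and> s y = v. point_mass m x y)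
           - (\<Sum>y | y \<in> atoms p \<and> t y = v. p y)"
    using G \<open>m > 0\<close> unfolding Path_def E_def by (auto simp: atoms_point_mass)
  have finE: "finite E" using fin EV by (meson finite_SigmaI finite_subset)
  have finp: "finite (atoms p)" using \<open>atomic p\<close> by (rule atomic_finite)
  have "T \<le> m" unfolding T_def \<open>mass p = m\<close>[symmetric] mass_def
    using finp \<open>atomic p\<close> by (intro sum_mono2) (auto simp: atomic_nonneg)
  have "T \<ge> 0" unfolding T_def using \<open>atomic p\<close> by (intro sum_nonneg) (auto simp: atomic_nonneg)
  \<comment> \<open>The cut is the open ball of radius \<rho>. It contains the whole source, while
    the sinks at distance at least \<open>r\<close> lie outside, so a mass of at least
    \<open>T\<close> has to leave it.\<close>
  have flux: "T \<le> (\<Sum>e | e \<in> E \<and> d (fst e) < \<rho> \<and> \<rho> \<le> d (snd e). weight G e)"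
    if \<rho>: "0 < \<rho>" "\<rho> < r" for \<rho>
  proof -
    define S where "S = {v \<in> vertices G. d v < \<rho>}"
    have "finite S" using fin by (simp add: S_def)
    have balS: "(\<Sum>e | e \<in> E \<and> fst e = v. weight G e) =
           (\<Sum>e | e \<in> E \<and> snd e = v. weight G e)
           + (\<Sum>y | y \<in> atoms (point_mass m x) \<and> s y = v. point_mass m x y)
           - (\<Sum>y | y \<in> atoms p \<and> t y = v. p y)" if "v \<in> S" for v
      using bal that by (auto simp: S_def)
    have cut: "(\<Sum>e | e \<in> E \<and> fst e \<in> S \<and> snd e \<notin> S. weight G e) =
         (\<Sum>e | e \<in> E \<and> fst e \<notin> S \<and> snd e \<in> S. weight G e)
         + (\<Sum>y | y \<in> atoms (point_mass m x) \<and> s y \<in> S. point_mass m x y)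
         - (\<Sum>y | y \<in> atoms p \<and> t y \<in> S. p y)"
      by (rule cut_balance[OF finE _ _ \<open>finite S\<close> balS])
         (use assms in \<open>auto simp: atoms_point_mass atomic_finite\<close>)
    have "{y. y \<in> atoms (point_mass m x) \<and> s y \<in> S} = {x}"
      using s \<rho> \<open>m > 0\<close> by (auto simp: atoms_point_mass S_def d_def)
    then have src: "(\<Sum>y | y \<in> atoms (point_mass m x) \<and> s y \<in> S. point_mass m x y) = m"
      by (simp add: point_mass_def)
    have "(\<Sum>y | y \<in> atoms p \<and> t y \<in> S. p y) + T \<le> mass p"
    proof -
      have "(\<Sum>y | y \<in> atoms p \<and> t y \<in> S. p y) + T =
        sum p ({y \<in> atoms p. t y \<in> S} \<union> {z \<in> atoms p. dist x z \<ge> r})"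
        unfolding T_def using finp t \<rho>
        by (subst sum.union_disjoint) (auto simp: S_def d_def disjoint_iff)
      also have "\<dots> \<le> mass p" unfolding mass_def
        using finp \<open>atomic p\<close> by (intro sum_mono2) (auto simp: atomic_nonneg)
      finally show ?thesis .
    qed
    moreover have "(\<Sum>e | e \<in> E \<and> fst e \<notin> S \<and> snd e \<in> S. weight G e) \<ge> 0"
      using wpos by (intro sum_nonneg) (auto simp: less_imp_le)
    ultimately have "T \<le> (\<Sum>e | e \<in> E \<and> fst e \<in> S \<and> snd e \<notin> S. weight G e)"
      using cut src \<open>mass p = m\<close> by linarith
    also have "{e. e \<in> E \<and> fst e \<in> S \<and> snd e \<notin> S} = {e. e \<in> E \<and> d (fst e) < \<rho> \<and> \<rho> \<le> d (snd e)}"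
      using EV by (auto simp: S_def)
    finally show ?thesis .
  qed
  define K where "K = m powr (\<alpha> - 1) * T"
  have powr_flux: "K \<le> (\<Sum>e | e \<in> E \<and> d (fst e) < \<rho> \<and> \<rho> \<le> d (snd e). weight G e powr \<alpha>)"
    if \<rho>: "0 < \<rho>" "\<rho> < r" for \<rho>
  proof (cases "\<exists>e\<in>E. d (fst e) < \<rho> \<and> \<rho> \<le> d (snd e) \<and> weight G e > m")
    case True
    then obtain e where e: "e \<in> E" "d (fst e) < \<rho>" "\<rho> \<le> d (snd e)" "weight G e > m" by blast
    have "\<alpha> \<ge> 0"
      using acyclic_weight_le[OF G _ \<open>m > 0\<close> \<open>atomic p\<close>, of e] e by (force simp: E_def)
    have "K \<le> m powr (\<alpha> - 1) * m powr 1" unfolding K_def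
      using \<open>T \<le> m\<close> \<open>m > 0\<close> by (intro mult_left_mono) auto
    also have "\<dots> = m powr \<alpha>" by (subst powr_add[symmetric]) simp
    also have "\<dots> \<le> weight G e powr \<alpha>" using e \<open>m > 0\<close> \<open>\<alpha> \<ge> 0\<close> by (intro powr_mono2) auto
    also have "\<dots> \<le> (\<Sum>e | e \<in> E \<and> d (fst e) < \<rho> \<and> \<rho> \<le> d (snd e). weight G e powr \<alpha>)"
      using e finE by (intro member_le_sum[of e _ "\<lambda>e. weight G e powr \<alpha>"]) auto
    finally show ?thesis .
  next
    case False
    have "K \<le> m powr (\<alpha> - 1) * (\<Sum>e | e \<in> E \<and> d (fst e) < \<rho> \<and> \<rho> \<le> d (snd e). weight G e)"
      unfolding K_def using flux[OF \<rho>] by (intro mult_left_mono) auto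
    also have "\<dots> \<le> (\<Sum>e | e \<in> E \<and> d (fst e) < \<rho> \<and> \<rho> \<le> d (snd e). weight G e powr \<alpha>)"
      unfolding sum_distrib_left
    proof (rule sum_mono)
      fix e assume e: "e \<in> {e \<in> E. d (fst e) < \<rho> \<and> \<rho> \<le> d (snd e)}"
      then have w: "0 < weight G e" "weight G e \<le> m" using False wpos by auto
      have "m powr (\<alpha> - 1) * weight G e \<le> weight G e powr (\<alpha> - 1) * weight G e powr 1"
        using w \<open>\<alpha> < 1\<close> by (intro mult_mono powr_mono2') auto
      also have "\<dots> = weight G e powr \<alpha>" by (subst powr_add[symmetric]) simp
      finally show "m powr (\<alpha> - 1) * weight G e \<le> weight G e powr \<alpha>" .
    qed
    finally show ?thesis .
  qed
  have "K * r = (\<integral>\<rho>. K * indicator {0<..<r} \<rho> \<partial>lborel)"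
    using \<open>r > 0\<close> by simp
  \<comment> \<open>Each edge is counted for exactly those radii \<rho> whose sphere it crosses
    outwards. Integration turns this into the growth of the distance from \<open>x\<close> along the
    edge, which the triangle inequality bounds by the length of the edge.\<close>
  also have "\<dots> \<le> (\<integral>\<rho>. (\<Sum>e\<in>E. weight G e powr \<alpha> * indicator {d (fst e)<..d (snd e)} \<rho>) \<partial>lborel)"
  proof (rule integral_mono)
    show "integrable lborel (\<lambda>\<rho>. K * indicator {0<..<r} \<rho>)"
      using \<open>r > 0\<close> by (intro integrable_mult_right integrable_real_indicator) auto
    show "integrable lborel (\<lambda>\<rho>. \<Sum>e\<in>E. weight G e powr \<alpha> * indicator {d (fst e)<..d (snd e)} \<rho>)"
      by (intro Bochner_Integration.integrable_sum integrable_mult_right integral_indicator_Ioc)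
    fix \<rho> :: real
    have "(\<Sum>e\<in>E. weight G e powr \<alpha> * indicator {d (fst e)<..d (snd e)} \<rho>) =
       (\<Sum>e | e \<in> E \<and> d (fst e) < \<rho> \<and> \<rho> \<le> d (snd e). weight G e powr \<alpha>)"
      unfolding sum.inter_filter[OF finE] by (intro sum.cong) (auto simp: indicator_def)
    moreover have "0 \<le> (\<Sum>e | e \<in> E \<and> d (fst e) < \<rho> \<and> \<rho> \<le> d (snd e). weight G e powr \<alpha>)"
      by (intro sum_nonneg) auto
    ultimately show "K * indicator {0<..<r} \<rho> \<le>
        (\<Sum>e\<in>E. weight G e powr \<alpha> * indicator {d (fst e)<..d (snd e)} \<rho>)"
      using powr_flux[of \<rho>] by (auto simp: indicator_def)
  qed
  also have "\<dots> = (\<Sum>e\<in>E. weight G e powr \<alpha> * max 0 (d (snd e) - d (fst e)))"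
    by (subst Bochner_Integration.integral_sum)
       (auto intro!: integrable_mult_right integral_indicator_Ioc
          simp only: integral_mult_right_zero integral_indicator_Ioc(2))
  also have "\<dots> \<le> M_cost \<alpha> G" unfolding M_cost_def E_def
  proof (intro sum_mono mult_left_mono)
    fix e
    show "max 0 (d (snd e) - d (fst e)) \<le> dist (pos G (fst e)) (pos G (snd e))"
      unfolding d_def using dist_triangle[of x "pos G (snd e)" "pos G (fst e)"] by simp
  qed auto
  finally have "m powr (1 - \<alpha>) * (K * r) \<le> m powr (1 - \<alpha>) * M_cost \<alpha> G"
    by (intro mult_left_mono) auto
  moreover have "m powr (1 - \<alpha>) * (K * r) = r * T"
    unfolding K_def using \<open>m > 0\<close> by (simp add: powr_diff field_simps)
  ultimately show ?thesis by (simp add: T_def)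
qed

section \<open>Covers by small balls from weak convergence\<close>

lemma integral_atomic_measure:
  fixes f :: "'a::metric_space \<Rightarrow> real"
  assumes "atomic a" and f: "continuous_on UNIV f"
  shows "(\<integral>x. f x \<partial>atomic_measure a) = (\<Sum>x\<in>atoms a. a x * f x)"
proof -
  have "f \<in> borel_measurable borel" using f by (rule borel_measurable_continuous_onI)
  then have "(\<integral>x. f x \<partial>atomic_measure a) = (\<integral>x. f x \<partial>density (count_space UNIV) (\<lambda>x. ennreal (a x)))"
    unfolding atomic_measure_def by (intro integral_distr) auto
  also have "\<dots> = (\<integral>x. a x *\<^sub>R f x \<partial>count_space UNIV)"
    by (rule integral_density) (auto simp: atomic_nonneg[OF \<open>atomic a\<close>])
  also have "\<dots> = (\<Sum>x | x \<in> UNIV \<and> a x *\<^sub>R f x \<noteq> 0. a x *\<^sub>R f x)"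
    by (rule lebesgue_integral_count_space_finite_support)
       (rule finite_subset[OF _ atomic_finite[OF \<open>atomic a\<close>]], auto simp: atoms_def)
  also have "\<dots> = (\<Sum>x\<in>atoms a. a x * f x)"
    using atomic_finite[OF \<open>atomic a\<close>]
    by (intro sum.mono_neutral_cong_left) (auto simp: atoms_def)
  finally show ?thesis .
qed

text \<open>The truncated multiples of \<open>infdist z U\<close> vanish on \<open>U\<close> and
  converge pointwise to the indicator of its complement, so dominated convergence carries the bound
  over. Nonemptiness of \<open>U\<close> matters since \<open>infdist z {} = 0\<close>.\<close>

lemma measure_compl_le_of_test_functions:
  fixes \<mu> :: "'a::metric_space measure"
  assumes "prob_space \<mu>" and sets: "sets \<mu> = sets borel" and U: "closed U" "U \<noteq> {}"
    and test: "\<And>f :: 'a \<Rightarrow> real. continuous_on UNIV f \<Longrightarrow> (\<And>z. 0 \<le> f z \<and> f z \<le> 1) \<Longrightarrow>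
      (\<And>z. z \<in> U \<Longrightarrow> f z = 0) \<Longrightarrow> (\<integral>x. f x \<partial>\<mu>) \<le> L"
  shows "measure \<mu> (- U) \<le> L"
proof -
  interpret prob_space \<mu> by fact
  have meas: "f \<in> borel_measurable \<mu>" if "continuous_on UNIV f" for f :: "'a \<Rightarrow> real"
    using borel_measurable_continuous_onI[OF that] by (simp add: measurable_cong_sets[OF sets refl])
  have compl: "- U \<in> sets \<mu>" using U sets by auto
  define f where "f j z = min 1 (real j * infdist z U)" for j z
  have cont: "continuous_on UNIV (f j)" for j unfolding f_def by (intro continuous_intros)
  have "(\<lambda>j. \<integral>x. f j x \<partial>\<mu>) \<longlonglongrightarrow> (\<integral>x. indicator (- U) x \<partial>\<mu>)"
  proof (rule integral_dominated_convergence[where w = "\<lambda>_. 1"])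
    show "AE x in \<mu>. (\<lambda>j. f j x) \<longlonglongrightarrow> indicator (- U) x"
    proof (rule AE_I2)
      fix x
      show "(\<lambda>j. f j x) \<longlonglongrightarrow> indicator (- U) x"
      proof (cases "x \<in> U")
        case True
        then show ?thesis by (simp add: f_def)
      next
        case False
        then have pos: "infdist x U > 0" by (rule infdist_pos_not_in_closed[OF U])
        have "eventually (\<lambda>j. f j x = 1) sequentially"
        proof (rule eventually_sequentiallyI)
          fix j assume "nat \<lceil>1 / infdist x U\<rceil> \<le> j"
          then have "1 / infdist x U \<le> real j" by linarith
          then show "f j x = 1" using pos by (simp add: f_def field_simps)
        qed
        then show ?thesis using False by (simp add: tendsto_eventually)
      qed
    qed
  qed (use compl in \<open>auto simp: f_def infdist_nonneg intro!: meas continuous_intros\<close>)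
  moreover have "(\<integral>x. f j x \<partial>\<mu>) \<le> L" for j
    by (rule test[OF cont]) (auto simp: f_def infdist_nonneg)
  ultimately have "(\<integral>x. indicator (- U) x \<partial>\<mu>) \<le> L"
    by (intro LIMSEQ_le_const2) auto
  then show ?thesis using compl by simp
qed

text \<open>In \<open>mass_moved_le_cost\<close> with radius
  \<open>L * m powr (1 - \<alpha>)\<close> the power of \<open>m\<close> cancels: each path moves at
  most its cost divided by \<open>L\<close> out of its ball. A total cost of at most
  \<open>L\<^sup>2\<close> therefore leaves at most \<open>L\<close> outside the balls for every
  later measure of the sequence, and the bound passes to the weak limit.\<close>

lemma D_class_small_cover:
  fixes \<mu> :: "'a::metric_space measure"
  assumes "\<mu> \<in> D_class \<alpha>" and "\<alpha> < 1" and L: "L > 0"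
  obtains F and \<rho> :: "'a \<Rightarrow> real" where "finite F" "\<And>x. x \<in> F \<Longrightarrow> 0 \<le> \<rho> x \<and> \<rho> x \<le> L"
    "(\<Sum>x\<in>F. \<rho> x powr (1 / (1 - \<alpha>))) \<le> L powr (1 / (1 - \<alpha>))"
    "measure \<mu> (- (\<Union>x\<in>F. cball x (\<rho> x))) \<le> L"
proof -
  from assms(1) obtain a where prob: "prob_space \<mu>" and sets: "sets \<mu> = sets borel"
    and adm: "admissible_Cauchy \<alpha> a" and mass1: "\<And>k. mass (a k) = 1"
    and weak: "weakly_converges (\<lambda>k. atomic_measure (a k)) \<mu>"
    unfolding D_class_def by auto
  have at: "atomic (a k)" for k using adm by (simp add: admissible_Cauchy_def)
  have "L\<^sup>2 > 0" using L by simp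
  from adm[unfolded admissible_Cauchy_def, THEN conjunct2, THEN conjunct2, THEN spec, THEN mp, OF this]
  obtain k where k: "\<forall>k'\<ge>k. \<forall>n>k'.
        \<exists>(p :: 'a \<Rightarrow> 'a \<Rightarrow> real) (G :: 'a \<Rightarrow> 'a transport_graph).
          (\<forall>x\<in>atoms (a k'). atomic (p x) \<and> mass (p x) = a k' x) \<and>
          disjoint_family_on (\<lambda>x. atoms (p x)) (atoms (a k')) \<and>
          (\<forall>z. a n z = (\<Sum>x\<in>atoms (a k'). p x z)) \<and>
          (\<forall>x\<in>atoms (a k'). G x \<in> Path \<alpha> (point_mass (a k' x) x) (p x)) \<and>
          (\<Sum>x\<in>atoms (a k'). M_cost \<alpha> (G x)) \<le> L\<^sup>2"
    by (rule exE)
  define F where "F = atoms (a k)"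
  have "finite F" using atomic_finite[OF at] by (simp add: F_def)
  have "F \<noteq> {}" using mass1[of k] by (auto simp: F_def mass_def)
  have pos: "a k x > 0" if "x \<in> F" for x using at that by (auto simp: F_def atomic_def)
  have le1: "a k x \<le> 1" if "x \<in> F" for x
    unfolding mass1[of k, symmetric] mass_def using that atomic_finite[OF at] atomic_nonneg[OF at]
    by (intro member_le_sum) (auto simp: F_def)
  \<comment> \<open>The exponent is chosen so that \<open>\<rho> x powr (1 / (1 - \<alpha>))\<close>
    is proportional to the mass of \<open>x\<close>; the total mass 1 then bounds the sum.\<close>
  define \<rho> where "\<rho> x = L * a k x powr (1 - \<alpha>)" for x
  have \<rho>: "0 < \<rho> x" "\<rho> x \<le> L" if "x \<in> F" for x
    using pos[OF that] le1[OF that] L \<open>\<alpha> < 1\<close> powr_le1[of "1 - \<alpha>" "a k x"]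
    by (auto simp: \<rho>_def)
  define U where "U = (\<Union>x\<in>F. cball x (\<rho> x))"
  have "(\<Sum>x\<in>F. \<rho> x powr (1 / (1 - \<alpha>))) = (\<Sum>x\<in>F. L powr (1 / (1 - \<alpha>)) * a k x)"
    using L \<open>\<alpha> < 1\<close> pos by (intro sum.cong) (auto simp: \<rho>_def powr_mult powr_powr less_imp_le)
  also have "\<dots> = L powr (1 / (1 - \<alpha>))"
    using mass1[of k] by (simp add: sum_distrib_left[symmetric] mass_def F_def)
  finally have sum_\<rho>: "(\<Sum>x\<in>F. \<rho> x powr (1 / (1 - \<alpha>))) = L powr (1 / (1 - \<alpha>))" .
  have "measure \<mu> (- U) \<le> L"
  proof (rule measure_compl_le_of_test_functions[OF prob sets])
    show "closed U" unfolding U_def using \<open>finite F\<close> by (intro closed_UN) auto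
    show "U \<noteq> {}" unfolding U_def using \<open>F \<noteq> {}\<close> \<rho> by (fastforce simp: less_imp_le)
    fix f :: "'a \<Rightarrow> real"
    assume f: "continuous_on UNIV f" "\<And>z. 0 \<le> f z \<and> f z \<le> 1" "\<And>z. z \<in> U \<Longrightarrow> f z = 0"
    have "bounded (range f)" using f(2) by (auto simp: bounded_iff intro!: exI[of _ 1])
    then have lim: "(\<lambda>n. \<integral>x. f x \<partial>atomic_measure (a n)) \<longlonglongrightarrow> (\<integral>x. f x \<partial>\<mu>)"
      using weak f(1) by (auto simp: weakly_converges_def)
    have "(\<integral>x. f x \<partial>atomic_measure (a n)) \<le> L" if "n > k" for n
    proof -
      from k[THEN spec, THEN mp, OF order_refl, THEN spec, THEN mp, OF that, folded F_def]
      obtain p G where *: "\<forall>x\<in>F. atomic (p x) \<and> mass (p x) = a k x" "\<forall>z. a n z = (\<Sum>x\<in>F. p x z)"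
        "\<forall>x\<in>F. G x \<in> Path \<alpha> (point_mass (a k x) x) (p x)"
        and cost: "(\<Sum>x\<in>F. M_cost \<alpha> (G x)) \<le> L\<^sup>2"
        by (elim exE conjE)
      note p = *(1)[rule_format] and sum_p = *(2)[rule_format] and G = *(3)[rule_format]
      have sub: "atoms (p x) \<subseteq> atoms (a n)" if "x \<in> F" for x
      proof
        fix z assume "z \<in> atoms (p x)"
        then have "0 < p x z" using p[OF that] by (auto simp: atomic_def)
        also have "\<dots> \<le> (\<Sum>x\<in>F. p x z)"
          using p that \<open>finite F\<close> by (intro member_le_sum) (auto simp: atomic_nonneg)
        finally show "z \<in> atoms (a n)" by (simp add: sum_p atoms_def)
      qed
      have "(\<integral>x. f x \<partial>atomic_measure (a n)) = (\<Sum>z\<in>atoms (a n). \<Sum>x\<in>F. p x z * f z)"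
        by (simp add: integral_atomic_measure[OF at f(1)] sum_p sum_distrib_right)
      also have "\<dots> = (\<Sum>x\<in>F. \<Sum>z\<in>atoms (a n). p x z * f z)" by (rule sum.swap)
      also have "\<dots> \<le> (\<Sum>x\<in>F. M_cost \<alpha> (G x) / L)"
      proof (rule sum_mono)
        fix x assume x: "x \<in> F"
        have "(\<Sum>z\<in>atoms (a n). p x z * f z) = (\<Sum>z\<in>atoms (p x). p x z * f z)"
          using sub[OF x] atomic_finite[OF at] by (intro sum.mono_neutral_right) (auto simp: atoms_def)
        also have "\<dots> \<le> (\<Sum>z\<in>atoms (p x). if dist x z \<ge> \<rho> x then p x z else 0)"
        proof (rule sum_mono)
          fix z
          have "p x z * f z \<le> p x z * 1"
            using p[OF x] f(2) by (intro mult_left_mono) (auto simp: atomic_nonneg)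
          moreover have "f z = 0" if "dist x z < \<rho> x"
            using f(3)[of z] that x by (force simp: U_def)
          ultimately show "p x z * f z \<le> (if dist x z \<ge> \<rho> x then p x z else 0)" by auto
        qed
        also have "\<dots> = (\<Sum>z | z \<in> atoms (p x) \<and> dist x z \<ge> \<rho> x. p x z)"
          using p[OF x] by (simp add: sum.inter_filter atomic_finite)
        also have "\<dots> \<le> M_cost \<alpha> (G x) / L"
        proof -
          have "\<rho> x * (\<Sum>z | z \<in> atoms (p x) \<and> dist x z \<ge> \<rho> x. p x z)
              \<le> a k x powr (1 - \<alpha>) * M_cost \<alpha> (G x)"
            using mass_moved_le_cost[OF G[OF x] \<open>\<alpha> < 1\<close> pos[OF x]] p[OF x] \<rho>[OF x] by auto
          then show ?thesis using L pos[OF x] by (simp add: \<rho>_def field_simps)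
        qed
        finally show "(\<Sum>z\<in>atoms (a n). p x z * f z) \<le> M_cost \<alpha> (G x) / L" .
      qed
      also have "\<dots> \<le> L" using cost L by (simp add: sum_divide_distrib[symmetric] field_simps power2_eq_square)
      finally show ?thesis .
    qed
    then show "(\<integral>x. f x \<partial>\<mu>) \<le> L"
      by (intro LIMSEQ_le_const2[OF lim]) (auto intro!: exI[of _ "Suc k"])
  qed
  then show thesis using \<open>finite F\<close> \<rho> sum_\<rho> by (intro that[of F \<rho>]) (auto simp: U_def less_imp_le)
qed

section \<open>Null sets of Hausdorff measure as limsup sets\<close>

lemma finite_family_as_sequence:
  fixes h :: "'b set \<Rightarrow> 'c::{comm_monoid_add,t2_space}"
  assumes "finite F" and "h {} = 0"
  obtains b :: "nat \<Rightarrow> 'b set" where "(\<Union>i. b i) = (\<Union>x\<in>F. B x)" "\<And>i. b i = {} \<or> b i \<in> B ` F"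
    "(\<Sum>i. h (b i)) = (\<Sum>x\<in>F. h (B x))"
proof -
  obtain g where g: "bij_betw g {0..<card F} F" using ex_bij_betw_nat_finite[OF \<open>finite F\<close>] by blast
  \<comment> \<open>\<open>Hausdorff_premeasure\<close> asks for infinite sequences; padding with
    the empty set costs nothing because \<open>h {} = 0\<close>.\<close>
  define b where "b i = (if i < card F then B (g i) else {})" for i
  have "(\<Union>x\<in>F. B x) = (\<Union>i\<in>{0..<card F}. B (g i))"
    using bij_betw_imp_surj_on[OF g] by (metis image_image)
  also have "\<dots> = (\<Union>i. b i)" by (auto simp: b_def)
  finally have 1: "(\<Union>i. b i) = (\<Union>x\<in>F. B x)" ..
  have 2: "b i = {} \<or> b i \<in> B ` F" for i
    using bij_betwE[OF g] by (auto simp: b_def)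
  have "(\<Sum>i. h (b i)) = (\<Sum>i\<in>{0..<card F}. h (b i))"
    by (rule suminf_finite) (auto simp: b_def \<open>h {} = 0\<close>)
  also have "\<dots> = (\<Sum>i\<in>{0..<card F}. h (B (g i)))" by (auto simp: b_def)
  also have "\<dots> = (\<Sum>x\<in>F. h (B x))" by (rule sum.reindex_bij_betw[OF g])
  finally show thesis using that 1 2 by blast
qed

text \<open>A Borel-Cantelli argument: for each \<open>k\<close> the sets with first index at least
  \<open>k\<close> cover the limsup set, and for large \<open>k\<close> both their diameters and
  their total sum are arbitrarily small.\<close>

lemma Hausdorff_measure_limsup_zero:
  fixes U :: "nat \<Rightarrow> nat \<Rightarrow> 'a::metric_space set"
  assumes bdd: "\<And>j i. bounded (U j i)" and diam: "\<And>j i. diameter (U j i) \<le> \<delta> j" and "\<delta> \<longlonglongrightarrow> 0"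
    and sum: "\<And>j. (\<Sum>i. diam_power s (U j i)) \<le> ennreal (c j)" and "summable c" "\<And>j. 0 \<le> c j"
  shows "Hausdorff_measure s (\<Inter>k. \<Union>j\<in>{k..}. \<Union>i. U j i) = 0" (is "Hausdorff_measure s ?A = 0")
proof -
  have "Hausdorff_premeasure \<epsilon> s ?A \<le> 0" if "\<epsilon> > 0" for \<epsilon>
  proof (rule ennreal_le_epsilon)
    fix \<eta> :: real assume "\<eta> > 0"
    have tail: "(\<lambda>k. \<Sum>j. c (j + k)) \<longlonglongrightarrow> 0" using suminf_exist_split2[OF \<open>summable c\<close>] .
    have "eventually (\<lambda>k. (\<Sum>j. c (j + k)) < \<eta> \<and> (\<forall>j\<ge>k. \<delta> j < \<epsilon>)) sequentially"
      using order_tendstoD(2)[OF tail \<open>\<eta> > 0\<close>]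
        eventually_all_ge_at_top[OF order_tendstoD(2)[OF \<open>\<delta> \<longlonglongrightarrow> 0\<close> \<open>\<epsilon> > 0\<close>]]
      by eventually_elim auto
    then obtain k where k: "(\<Sum>j. c (j + k)) < \<eta>" "\<And>j. j \<ge> k \<Longrightarrow> \<delta> j < \<epsilon>"
      by (auto simp: eventually_sequentially)
    define V where "V n = (case prod_decode n of (j, i) \<Rightarrow> U (j + k) i)" for n
    have "?A \<subseteq> (\<Union>n. V n)"
    proof
      fix x assume "x \<in> ?A"
      then obtain j i where "j \<ge> k" "x \<in> U j i" by blast
      then have "x \<in> V (prod_encode (j - k, i))" by (simp add: V_def)
      then show "x \<in> (\<Union>n. V n)" by blast
    qed
    moreover have "bounded (V n) \<and> diameter (V n) \<le> \<epsilon>" for n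
      using bdd diam order_trans[OF diam less_imp_le[OF k(2)]] by (auto simp: V_def split: prod.split)
    ultimately have "Hausdorff_premeasure \<epsilon> s ?A \<le> (\<Sum>n. diam_power s (V n))"
      unfolding Hausdorff_premeasure_def by (intro Inf_lower) blast
    also have "(\<Sum>n. diam_power s (V n)) =
        (\<Sum>n. (\<lambda>(j, i). diam_power s (U (j + k) i)) (prod_decode n))"
      by (simp add: V_def case_prod_unfold)
    also have "\<dots> = (\<Sum>j. \<Sum>i. diam_power s (U (j + k) i))"
      by (rule suminf_ennreal_2dimen) simp
    also have "\<dots> \<le> (\<Sum>j. ennreal (c (j + k)))"
      by (intro suminf_le sum) auto
    also have "\<dots> = ennreal (\<Sum>j. c (j + k))"
      using \<open>summable c\<close> assms(6) by (intro suminf_ennreal2) (auto simp: summable_iff_shift)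
    also have "\<dots> \<le> 0 + ennreal \<eta>" using k(1) by (simp add: ennreal_leI)
    finally show "Hausdorff_premeasure \<epsilon> s ?A \<le> 0 + ennreal \<eta>" .
  qed
  then show ?thesis by (simp add: Hausdorff_measure_def)
qed

text \<open>The covers for \<open>L = (1/2) ^ j\<close> are combined into the set of points that
  belong to infinitely many of them. Geometric decay makes its \<open>s\<close>-dimensional measure
  vanish, and the small measure left uncovered at each \<open>j\<close> makes its complement
  null.\<close>

lemma dim_H_le_of_D_class:
  fixes \<mu> :: "'a::euclidean_space measure"
  assumes D: "\<mu> \<in> D_class \<alpha>" and "\<alpha> < 1"
  shows "dim_H \<mu> \<le> ereal (1 / (1 - \<alpha>))"
proof -
  define s where "s = 1 / (1 - \<alpha>)"
  have "s > 0" using \<open>\<alpha> < 1\<close> by (simp add: s_def)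
  have sets: "sets \<mu> = sets borel" and "prob_space \<mu>" using D by (auto simp: D_class_def)
  interpret prob_space \<mu> by fact
  define L :: "nat \<Rightarrow> real" where "L j = (1/2) ^ j" for j
  have Lpos: "L j > 0" for j by (simp add: L_def)
  define good where "good j F \<rho> \<longleftrightarrow> finite F \<and> (\<forall>x\<in>F. 0 \<le> \<rho> x \<and> \<rho> x \<le> L j) \<and>
    (\<Sum>x\<in>F. \<rho> x powr s) \<le> L j powr s \<and> measure \<mu> (- (\<Union>x\<in>F. cball x (\<rho> x))) \<le> L j"
    for j F \<rho>
  have "\<exists>F \<rho>. good j F \<rho>" for j
    by (rule D_class_small_cover[OF D \<open>\<alpha> < 1\<close> Lpos[of j]]) (unfold good_def s_def, blast)
  then obtain F \<rho> where good: "\<And>j. good j (F j) (\<rho> j)" by metis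
  have F: "\<And>j. finite (F j)" "\<And>j x. x \<in> F j \<Longrightarrow> 0 \<le> \<rho> j x \<and> \<rho> j x \<le> L j"
    "\<And>j. (\<Sum>x\<in>F j. \<rho> j x powr s) \<le> L j powr s"
    "\<And>j. measure \<mu> (- (\<Union>x\<in>F j. cball x (\<rho> j x))) \<le> L j"
    by (use good in \<open>simp_all add: good_def\<close>)
  define seq where "seq j b \<longleftrightarrow> (\<Union>i. b i) = (\<Union>x\<in>F j. cball x (\<rho> j x)) \<and>
    (\<forall>i. b i = {} \<or> b i \<in> (\<lambda>x. cball x (\<rho> j x)) ` F j) \<and>
    (\<Sum>i. diam_power s (b i)) = (\<Sum>x\<in>F j. diam_power s (cball x (\<rho> j x)))"
    for j and b :: "nat \<Rightarrow> 'a set"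
  have empty: "diam_power s ({} :: 'a set) = 0" by (simp add: diam_power_def)
  have "\<exists>b. seq j b" for j
    by (rule finite_family_as_sequence[where F = "F j" and h = "diam_power s"
          and B = "\<lambda>x. cball x (\<rho> j x)", OF F(1) empty]) (unfold seq_def, blast)
  then obtain U where seqU: "\<And>j. seq j (U j)" by metis
  have U: "\<And>j. (\<Union>i. U j i) = (\<Union>x\<in>F j. cball x (\<rho> j x))"
    "\<And>j i. U j i = {} \<or> U j i \<in> (\<lambda>x. cball x (\<rho> j x)) ` F j"
    "\<And>j. (\<Sum>i. diam_power s (U j i)) = (\<Sum>x\<in>F j. diam_power s (cball x (\<rho> j x)))"
    by (use seqU in \<open>simp_all add: seq_def\<close>)
  define A where "A = (\<Inter>k. \<Union>j\<in>{k..}. \<Union>i. U j i)"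
  have "Hausdorff_measure s A = 0" unfolding A_def
  proof (rule Hausdorff_measure_limsup_zero)
    show "bounded (U j i)" for j i using U(2)[of j i] by auto
    show "diameter (U j i) \<le> 2 * L j" for j i
      using U(2)[of j i] F(2)[of _ j] Lpos[of j] by (auto simp: less_imp_le)
    show "(\<lambda>j. 2 * L j) \<longlonglongrightarrow> 0"
      unfolding L_def by (intro tendsto_mult_right_zero LIMSEQ_power_zero) simp
    have "summable (\<lambda>j. ((1/2) powr s) ^ j)"
      using \<open>s > 0\<close> powr_less_mono2[of s "1/2" 1] by (intro summable_geometric) simp
    moreover have "((1/2) powr s) ^ j = L j powr s" for j
      by (simp add: L_def powr_powr powr_realpow[symmetric] mult.commute)
    ultimately show "summable (\<lambda>j. 2 powr s * L j powr s)"
      by (intro summable_mult) simp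
    fix j
    \<comment> \<open>In a Euclidean space the diameter of a ball is twice its radius, whence the
      factor \<open>2 powr s\<close>; \<open>s > 0\<close> rules out the special case of
      \<open>diam_power\<close>.\<close>
    have "diam_power s (cball x (\<rho> j x)) = ennreal (2 powr s * \<rho> j x powr s)" if "x \<in> F j" for x
      using F(2)[OF that] \<open>s > 0\<close> by (auto simp: diam_power_def powr_mult)
    then have "(\<Sum>i. diam_power s (U j i)) = (\<Sum>x\<in>F j. ennreal (2 powr s * \<rho> j x powr s))"
      unfolding U(3) by (intro sum.cong) auto
    also have "\<dots> = ennreal (2 powr s * (\<Sum>x\<in>F j. \<rho> j x powr s))"
      by (simp add: sum_distrib_left)
    also have "\<dots> \<le> ennreal (2 powr s * L j powr s)"
      by (intro ennreal_leI mult_left_mono F(3)) auto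
    finally show "(\<Sum>i. diam_power s (U j i)) \<le> ennreal (2 powr s * L j powr s)" .
  qed auto
  then have "Hausdorff_dim A \<le> ereal s"
    unfolding Hausdorff_dim_def using \<open>s > 0\<close> by (intro Inf_lower) (auto intro: less_imp_le)
  have UN: "(\<Union>i. U j i) \<in> sets \<mu>" for j
    unfolding U(1) sets using F(1) by (intro borel_closed closed_UN) auto
  have "A \<in> sets \<mu>" unfolding A_def using UN by (intro sets.countable_INT' sets.countable_UN') auto
  have space: "space \<mu> = UNIV" using sets_eq_imp_space_eq[OF sets] by simp
  \<comment> \<open>A point missed by the whole tail is missed by every single cover in it, so its
    measure is at most \<open>L j\<close> for all \<open>j \<ge> k\<close>.\<close>
  have "measure \<mu> (- (\<Union>j\<in>{k..}. \<Union>i. U j i)) \<le> 0" for k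
  proof (rule LIMSEQ_le_const)
    show "L \<longlonglongrightarrow> 0" unfolding L_def by (intro LIMSEQ_power_zero) simp
    have "measure \<mu> (- (\<Union>j\<in>{k..}. \<Union>i. U j i)) \<le> L j" if "j \<ge> k" for j
    proof -
      have "measure \<mu> (- (\<Union>j\<in>{k..}. \<Union>i. U j i)) \<le> measure \<mu> (- (\<Union>i. U j i))"
        using that sets.compl_sets[OF UN[of j]]
        by (intro finite_measure_mono) (auto simp: Compl_eq_Diff_UNIV space)
      also have "\<dots> \<le> L j" unfolding U(1) by (rule F(4))
      finally show ?thesis .
    qed
    then show "\<exists>N. \<forall>j\<ge>N. measure \<mu> (- (\<Union>j\<in>{k..}. \<Union>i. U j i)) \<le> L j" by blast
  qed
  then have null: "- (\<Union>j\<in>{k..}. \<Union>i. U j i) \<in> null_sets \<mu>" for k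
    using UN by (intro null_setsI)
      (auto simp: emeasure_eq_measure Compl_eq_Diff_UNIV space[symmetric] intro!: antisym sets.compl_sets sets.countable_UN')
  have "space \<mu> - A = (\<Union>k. - (\<Union>j\<in>{k..}. \<Union>i. U j i))"
    unfolding space A_def by auto
  then have "space \<mu> - A \<in> null_sets \<mu>" using null by (auto intro: null_sets_UN)
  then have "dim_H \<mu> \<le> Hausdorff_dim A"
    unfolding dim_H_def using \<open>A \<in> sets \<mu>\<close> by (intro Inf_lower) auto
  with \<open>Hausdorff_dim A \<le> ereal s\<close> show ?thesis by (simp add: s_def)
qed


section \<open>Transport along refining partitions\<close>

text \<open>Cells are addressed by their points: \<open>C n z\<close> is the cell of generation
  \<open>n\<close> around \<open>z\<close>, so equality of cells expresses membership in the same
  one. Inside the carrier \<open>X\<close> of full measure all cells have positive mass, which later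
  provides positive edge weights. The sequence \<open>e\<close> supplies the candidates for the
  points where mass is concentrated.\<close>

locale refining_partition = prob_space \<mu> for \<mu> :: "'a::metric_space measure" +
  fixes X :: "'a set" and C :: "nat \<Rightarrow> 'a \<Rightarrow> 'a set" and e :: "nat \<Rightarrow> 'a" and D :: "nat \<Rightarrow> real"
  assumes sets_eq: "sets \<mu> = sets borel"
    and X: "X \<in> events" "prob X = 1"
    and cell_refl: "\<And>n z. z \<in> X \<Longrightarrow> z \<in> C n z"
    and cell_subset: "\<And>n z. z \<in> X \<Longrightarrow> C n z \<subseteq> X"
    and cell_eq: "\<And>n z z'. z \<in> X \<Longrightarrow> z' \<in> C n z \<Longrightarrow> C n z' = C n z"
    and cell_Suc: "\<And>n z. z \<in> X \<Longrightarrow> C (Suc n) z \<subseteq> C n z"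
    and cell_events: "\<And>n z. z \<in> X \<Longrightarrow> C n z \<in> events"
    and cell_pos: "\<And>n z. z \<in> X \<Longrightarrow> prob (C n z) > 0"
    and finite_cells: "\<And>n. finite (C n ` X)"
    and e_in: "\<And>m. e m \<in> X"
    and e_dense: "\<And>n z. z \<in> X \<Longrightarrow> \<exists>m. e m \<in> C n z"
    and cell_diam: "\<And>n z z'. z \<in> X \<Longrightarrow> z' \<in> C n z \<Longrightarrow> dist z z' \<le> D n"
    and D_lim: "D \<longlonglongrightarrow> 0"
begin

section \<open>Representatives of cells\<close>

definition rep :: "nat \<Rightarrow> 'a \<Rightarrow> nat" where
  "rep n z = (LEAST m. e m \<in> C n z)"

text \<open>The fixed-point condition selects exactly one index per cell. Since \<open>e\<close> may
  repeat values, this is also what makes \<open>e\<close> injective on \<open>R n\<close>.\<close>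

definition R :: "nat \<Rightarrow> nat set" where
  "R n = {m. rep n (e m) = m}"

lemma e_rep: "z \<in> X \<Longrightarrow> e (rep n z) \<in> C n z"
  unfolding rep_def using e_dense by (metis LeastI)

lemma rep_le: "e m \<in> C n z \<Longrightarrow> rep n z \<le> m"
  unfolding rep_def by (rule Least_le)

lemma cell_mono: "z \<in> X \<Longrightarrow> k \<le> n \<Longrightarrow> C n z \<subseteq> C k z"
  using lift_Suc_antimono_le[of "\<lambda>n. C n z"] cell_Suc by blast

lemma cell_sym: "z \<in> X \<Longrightarrow> z' \<in> C n z \<Longrightarrow> z \<in> C n z'"
  using cell_eq cell_refl by metis

lemma rep_cong: "z \<in> X \<Longrightarrow> z' \<in> C n z \<Longrightarrow> rep n z' = rep n z"
  unfolding rep_def by (simp add: cell_eq)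

lemma rep_in_R: "z \<in> X \<Longrightarrow> rep n z \<in> R n"
  unfolding R_def by (simp add: rep_cong[OF _ e_rep])

lemma R_eqI:
  assumes "u \<in> R n" "v \<in> R n" "e u \<in> C n (e v)"
  shows "u = v"
  using rep_cong[OF e_in assms(3)] assms(1,2) by (simp add: R_def)

lemma rep_eq_iff: "v \<in> R n \<Longrightarrow> z \<in> X \<Longrightarrow> rep n z = v \<longleftrightarrow> z \<in> C n (e v)"
  using R_eqI[OF rep_in_R] cell_sym[OF _ e_rep] rep_cong[OF e_in] by (auto simp: R_def)

lemma inj_on_cell: "inj_on (\<lambda>v. C n (e v)) (R n)"
  by (rule inj_onI) (metis R_eqI cell_refl e_in)

lemma inj_on_e: "inj_on e (R n)"
  by (rule inj_onI) (auto simp: R_def)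

lemma finite_R: "finite (R n)"
  by (rule inj_on_finite[OF inj_on_cell _ finite_cells]) (auto simp: e_in)

lemma card_R_le: "card (R n) \<le> card (C n ` X)"
  by (rule card_inj_on_le[OF inj_on_cell _ finite_cells]) (auto simp: e_in)

text \<open>An index that is least for its cell of generation \<open>k\<close> is least for the
  smaller cell of generation \<open>n\<close> around the same point.\<close>

lemma R_mono: 
  assumes "k \<le> n" shows "R k \<subseteq> R n"
proof
  fix v assume v: "v \<in> R k"
  have "e (rep n (e v)) \<in> C k (e v)" using e_rep[OF e_in, of n v] cell_mono[OF e_in assms] by blast
  then have "v \<le> rep n (e v)" using rep_le[of "rep n (e v)" k "e v"] v by (simp add: R_def)
  moreover have "rep n (e v) \<le> v" by (rule rep_le[OF cell_refl[OF e_in]])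
  ultimately show "v \<in> R n" by (simp add: R_def)
qed

lemma cell_subset_cell:
  assumes "z \<in> X" "z' \<in> C k z" "k \<le> n" shows "C n z' \<subseteq> C k z"
  using cell_mono[of z' k n] cell_eq[OF assms(1,2)] cell_subset[OF assms(1)] assms by blast

lemma in_cell_trans:
  assumes "z \<in> X" "z' \<in> X" "x \<in> X" "z' \<in> C k x" "k \<le> l" "z \<in> C l z'" shows "z \<in> C k x"
  using cell_subset_cell[OF assms(3,4,5)] assms(6) by blast

lemma UN_cells:
  assumes "z \<in> X" "k \<le> n"
  shows "(\<Union>u\<in>{u \<in> R n. e u \<in> C k z}. C n (e u)) = C k z"
proof
  show "C k z \<subseteq> (\<Union>u\<in>{u \<in> R n. e u \<in> C k z}. C n (e u))"
  proof
    fix y assume y: "y \<in> C k z"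
    then have "y \<in> X" using cell_subset[OF assms(1)] by blast
    have "e (rep n y) \<in> C k z"
      using e_rep[OF \<open>y \<in> X\<close>] cell_subset_cell[OF assms(1) y assms(2)] by blast
    with rep_in_R[OF \<open>y \<in> X\<close>] cell_sym[OF \<open>y \<in> X\<close> e_rep[OF \<open>y \<in> X\<close>]] show "y \<in> (\<Union>u\<in>{u \<in> R n. e u \<in> C k z}. C n (e u))" by blast
  qed
qed (use cell_subset_cell[OF assms(1) _ assms(2)] in blast)

lemma disjoint_cells: "disjoint_family_on (\<lambda>u. C n (e u)) (R n)"
  unfolding disjoint_family_on_def
proof (intro ballI impI)
  fix u v assume uv: "u \<in> R n" "v \<in> R n" "u \<noteq> v"
  show "C n (e u) \<inter> C n (e v) = {}"
  proof (rule ccontr)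
    assume "\<not> ?thesis"
    then obtain z where "z \<in> C n (e u)" "z \<in> C n (e v)" by blast
    then have "C n (e u) = C n (e v)" using cell_eq[OF e_in] by metis
    then show False using inj_onD[OF inj_on_cell] uv by blast
  qed
qed

lemma prob_cell_eq_sum:
  assumes "z \<in> X" "k \<le> n"
  shows "prob (C k z) = (\<Sum>u | u \<in> R n \<and> e u \<in> C k z. prob (C n (e u)))"
proof -
  have "prob (\<Union>u\<in>{u \<in> R n. e u \<in> C k z}. C n (e u)) = (\<Sum>u\<in>{u \<in> R n. e u \<in> C k z}. prob (C n (e u)))"
    by (rule finite_measure_finite_Union)
       (use finite_R cell_events[OF e_in] disjoint_family_on_mono[OF _ disjoint_cells] in auto)
  then show ?thesis by (simp only: UN_cells[OF assms])
qed

lemma X_eq_UN: "(\<Union>u\<in>R n. C n (e u)) = X"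
proof
  show "X \<subseteq> (\<Union>u\<in>R n. C n (e u))"
  proof
    fix z assume z: "z \<in> X"
    show "z \<in> (\<Union>u\<in>R n. C n (e u))"
      using rep_in_R[OF z] cell_sym[OF z e_rep[OF z]] by blast
  qed
qed (use cell_subset[OF e_in] in blast)

lemma sum_prob_cells: "(\<Sum>u\<in>R n. prob (C n (e u))) = 1"
proof -
  have "prob (\<Union>u\<in>R n. C n (e u)) = (\<Sum>u\<in>R n. prob (C n (e u)))"
    by (rule finite_measure_finite_Union) (use finite_R cell_events[OF e_in] disjoint_cells in auto)
  then show ?thesis by (simp only: X_eq_UN X(2))
qed

section \<open>Atomic approximations and their weak limit\<close>

definition approx :: "nat \<Rightarrow> 'a \<Rightarrow> real" where
  "approx n z = (if z \<in> e ` R n then prob (C n z) else 0)"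

lemma atoms_approx: "atoms (approx n) = e ` R n"
proof -
  have "prob (C n (e m)) \<noteq> 0" for m using cell_pos[OF e_in, of n m] by simp
  then show ?thesis by (auto simp: atoms_def approx_def)
qed

lemma atomic_approx: "atomic (approx n)"
  using cell_pos[OF e_in] finite_R unfolding atomic_def atoms_approx by (auto simp: approx_def)

lemma approx_e: "v \<in> R n \<Longrightarrow> approx n (e v) = prob (C n (e v))"
  by (simp add: approx_def)

lemma mass_approx: "mass (approx n) = 1"
  unfolding mass_def atoms_approx sum.reindex[OF inj_on_e] o_def
  using sum_prob_cells by (simp add: approx_e cong: sum.cong)

text \<open>Integrating \<open>f\<close> against \<open>approx n\<close> is integrating over \<mu>
  the step function \<open>g n\<close> that takes on each cell the value of \<open>f\<close> at its
  representative. The cells shrink to points, so continuity gives \<open>g n\<close> tending to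
  \<open>f\<close> on \<open>X\<close>, and dominated convergence applies.\<close>

lemma weakly_converges_approx: "weakly_converges (\<lambda>n. atomic_measure (approx n)) \<mu>"
  unfolding weakly_converges_def
proof (intro allI impI, elim conjE)
  fix f :: "'a \<Rightarrow> real"
  assume f: "continuous_on UNIV f" and "bounded (range f)"
  then obtain B where B: "\<And>z. \<bar>f z\<bar> \<le> B" by (auto simp: bounded_iff)
  have f_meas: "f \<in> borel_measurable \<mu>"
    using borel_measurable_continuous_onI[OF f] by (simp add: measurable_cong_sets[OF sets_eq refl])
  define g where "g n z = (\<Sum>v\<in>R n. f (e v) * indicator (C n (e v)) z)" for n z
  have g_eq: "g n z = f (e (rep n z))" if z: "z \<in> X" for n z
  proof -
    have "f (e v) * indicator (C n (e v)) z = (if v = rep n z then f (e (rep n z)) else 0)"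
      if "v \<in> R n" for v
      using rep_eq_iff[OF that z] by (auto simp: indicator_def)
    then have "g n z = (\<Sum>v\<in>R n. if v = rep n z then f (e (rep n z)) else 0)"
      unfolding g_def by (intro sum.cong) auto
    also have "\<dots> = f (e (rep n z))" using rep_in_R[OF z] finite_R by (subst sum.delta) auto
    finally show ?thesis .
  qed
  have g_meas [measurable]: "g n \<in> borel_measurable \<mu>" for n
    unfolding g_def using cell_events[OF e_in] by measurable
  have int: "(\<integral>x. f x \<partial>atomic_measure (approx n)) = (\<integral>x. g n x \<partial>\<mu>)" for n
  proof -
    have "(\<integral>x. f x \<partial>atomic_measure (approx n)) = (\<Sum>v\<in>R n. approx n (e v) * f (e v))"
      unfolding integral_atomic_measure[OF atomic_approx f] atoms_approx sum.reindex[OF inj_on_e] by simp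
    also have "\<dots> = (\<Sum>v\<in>R n. f (e v) * prob (C n (e v)))"
      by (intro sum.cong) (auto simp: approx_e)
    also have "\<dots> = (\<Sum>v\<in>R n. \<integral>x. f (e v) * indicator (C n (e v)) x \<partial>\<mu>)"
      using cell_events[OF e_in] by simp
    also have "\<dots> = (\<integral>x. g n x \<partial>\<mu>)" unfolding g_def
      using cell_events[OF e_in]
      by (intro Bochner_Integration.integral_sum[symmetric] integrable_mult_right integrable_real_indicator)
         (auto simp: emeasure_eq_measure)
    finally show ?thesis .
  qed
  have AE_X: "AE x in \<mu>. x \<in> X" using X AE_prob_1 by blast
  have "(\<lambda>n. \<integral>x. g n x \<partial>\<mu>) \<longlonglongrightarrow> (\<integral>x. f x \<partial>\<mu>)"
  proof (rule integral_dominated_convergence[where w = "\<lambda>_. B"])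
    show "AE x in \<mu>. (\<lambda>n. g n x) \<longlonglongrightarrow> f x"
      using AE_X
    proof eventually_elim
      fix x assume x: "x \<in> X"
      have "(\<lambda>n. dist x (e (rep n x))) \<longlonglongrightarrow> 0"
        by (rule tendsto_sandwich[OF _ _ tendsto_const D_lim])
           (use cell_diam[OF x e_rep[OF x]] in auto)
      then have "(\<lambda>n. e (rep n x)) \<longlonglongrightarrow> x"
        by (subst tendsto_dist_iff) (simp add: dist_commute)
      moreover have "isCont f x" using f by (simp add: continuous_on_eq_continuous_at)
      ultimately have "(\<lambda>n. f (e (rep n x))) \<longlonglongrightarrow> f x" by (rule isCont_tendsto_compose[rotated])
      then show "(\<lambda>n. g n x) \<longlonglongrightarrow> f x" by (simp add: g_eq[OF x])
    qed
    show "AE x in \<mu>. norm (g n x) \<le> B" for n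
      using AE_X by eventually_elim (simp add: g_eq B)
  qed (use f_meas g_meas in auto)
  then show "(\<lambda>n. \<integral>x. f x \<partial>atomic_measure (approx n)) \<longlonglongrightarrow> (\<integral>x. f x \<partial>\<mu>)" by (simp add: int)
qed

section \<open>The transport tree: balance, membership in \<open>Path\<close>, cost\<close>

definition born :: "nat \<Rightarrow> 'a \<Rightarrow> nat \<Rightarrow> nat set" where
  "born k x l = {u \<in> R (Suc l) - R l. e u \<in> C k x}"

text \<open>Weights are functions of the edge alone, so the generation of an edge is recovered from
  its end vertex; this is possible because an index is born only once.\<close>

definition birth :: "nat \<Rightarrow> nat" where
  "birth u = (LEAST l. u \<in> R l)"

text \<open>
  The transport goes along a tree: a vertex that becomes representative in generation \<open>l + 1\<close> is fed
  by the representative of its cell of generation \<open>l\<close>. Choosing the least index in a cell as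
  representative makes the sets \<open>R n\<close> increasing and the edges strictly increasing.
\<close>

definition tree :: "nat \<Rightarrow> nat \<Rightarrow> 'a \<Rightarrow> 'a transport_graph" where
  "tree k n x = \<lparr>
     vertices = {v \<in> R n. e v \<in> C k x},
     edges = (\<Union>l\<in>{k..<n}. (\<lambda>u. (rep l (e u), u)) ` born k x l),
     weight = (\<lambda>(_, u). prob (C (birth u) (e u))),
     pos = e\<rparr>"

definition portion :: "nat \<Rightarrow> nat \<Rightarrow> 'a \<Rightarrow> 'a \<Rightarrow> real" where
  "portion k n x z = (if z \<in> C k x then approx n z else 0)"

lemma finite_born: "finite (born k x l)"
  using finite_R by (simp add: born_def)

lemma born_disjoint: "l \<noteq> l' \<Longrightarrow> born k x l \<inter> born k x l' = {}"
  using R_mono[of "Suc l" l'] R_mono[of "Suc l'" l] by (fastforce simp: born_def)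

lemma birth_born:
  assumes "u \<in> born k x l" shows "birth u = Suc l"
  unfolding birth_def
proof (rule Least_equality)
  show "u \<in> R (Suc l)" using assms by (simp add: born_def)
  fix l' assume "u \<in> R l'"
  then show "Suc l \<le> l'"
    using R_mono[of l' l] assms by (force simp: born_def not_less_eq_eq)
qed

lemma rep_born_less:
  assumes "u \<in> born k x l" shows "rep l (e u) < u"
  using assms rep_le[OF cell_refl[OF e_in], of l u] by (auto simp: born_def R_def)

text \<open>An edge is determined by its end vertex, and that vertex is born at a single level, so
  no edge is counted twice.\<close>

lemma sum_tree_edges:
  fixes f :: "nat \<times> nat \<Rightarrow> real"
  shows "sum f (edges (tree k n x)) = (\<Sum>l\<in>{k..<n}. \<Sum>u\<in>born k x l. f (rep l (e u), u))"
proof -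
  have "sum f (edges (tree k n x)) = (\<Sum>l\<in>{k..<n}. sum f ((\<lambda>u. (rep l (e u), u)) ` born k x l))"
    unfolding tree_def transport_graph.simps
    by (intro sum.UNION_disjoint) (use finite_born born_disjoint in \<open>auto simp: disjoint_iff\<close>)
  also have "\<dots> = (\<Sum>l\<in>{k..<n}. \<Sum>u\<in>born k x l. f (rep l (e u), u))"
    by (intro sum.cong refl, subst sum.reindex) (auto simp: inj_on_def)
  finally show ?thesis .
qed

lemma finite_tree_edges: "finite (edges (tree k n x))"
  by (simp add: tree_def finite_born)

lemma rep_in_cell:
  assumes "x \<in> X" "k \<le> l" "e u \<in> C k x" shows "e (rep l (e u)) \<in> C k x"
  using cell_subset_cell[OF assms(1,3,2)] e_rep[OF e_in] by blast

text \<open>Here \<open>s l v\<close> is the mass held at \<open>v\<close> in generation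
  \<open>l\<close>. Passing to generation \<open>l + 1\<close>, a representative keeps the mass of
  the subcell containing it and sends to each other subcell the mass of that subcell.\<close>

lemma level_balance:
  assumes x: "x \<in> X" and "k \<le> l"
  defines "s \<equiv> \<lambda>l v. if v \<in> R l \<and> e v \<in> C k x then prob (C l (e v)) else 0"
  shows "(\<Sum>u\<in>born k x l. if rep l (e u) = v then prob (C (Suc l) (e u)) else 0)
       - (\<Sum>u\<in>born k x l. if u = v then prob (C (Suc l) (e u)) else 0) = s l v - s (Suc l) v"
proof -
  let ?w = "\<lambda>u. prob (C (Suc l) (e u))"
  have In: "(\<Sum>u\<in>born k x l. if u = v then ?w u else 0) = (if v \<in> born k x l then ?w v else 0)"
    using finite_born by (subst sum.delta) auto
  have Out: "(\<Sum>u\<in>born k x l. if rep l (e u) = v then ?w u else 0) =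
      (\<Sum>u | u \<in> born k x l \<and> rep l (e u) = v. ?w u)"
    using finite_born by (simp add: sum.inter_filter)
  have Rl: "R l \<subseteq> R (Suc l)" by (rule R_mono) simp
  show ?thesis
  proof (cases "v \<in> R l \<and> e v \<in> C k x")
    case True
    \<comment> \<open>The vertices fed by \<open>v\<close> are the representatives of the subcells
      of its cell other than \<open>v\<close>: one that was already in \<open>R l\<close> would
      coincide with \<open>v\<close> by \<open>R_eqI\<close>.\<close>
    have "{u. u \<in> born k x l \<and> rep l (e u) = v} = {u. u \<in> R (Suc l) \<and> e u \<in> C l (e v)} - {v}"
      (is "?A = ?B")
    proof
      show "?A \<subseteq> ?B" using True rep_eq_iff[OF _ e_in] by (auto simp: born_def)
      show "?B \<subseteq> ?A"
        using True rep_eq_iff[OF _ e_in] R_eqI[of _ l v] in_cell_trans[OF e_in e_in x _ \<open>k \<le> l\<close>]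
        by (auto simp: born_def)
    qed
    then have "(\<Sum>u | u \<in> born k x l \<and> rep l (e u) = v. ?w u) =
        (\<Sum>u | u \<in> R (Suc l) \<and> e u \<in> C l (e v). ?w u) - ?w v"
      using finite_R Rl True cell_refl[OF e_in] by (auto simp: sum_diff1)
    also have "\<dots> = prob (C l (e v)) - ?w v"
      using prob_cell_eq_sum[OF e_in, of l "Suc l" v] by simp
    finally have "(\<Sum>u | u \<in> born k x l \<and> rep l (e u) = v. ?w u) = prob (C l (e v)) - ?w v" .
    then show ?thesis unfolding Out In using True Rl by (auto simp: s_def born_def)
  next
    case False
    \<comment> \<open>Only representatives of generation \<open>l\<close> inside the cell feed
      others. Such a \<open>v\<close> can only receive, and does so exactly when it is born at this
      level.\<close>
    have none: "{u. u \<in> born k x l \<and> rep l (e u) = v} = {}"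
      using False rep_in_R[OF e_in] rep_in_cell[OF x \<open>k \<le> l\<close>] by (auto simp: born_def)
    show ?thesis unfolding Out In none using False Rl by (auto simp: s_def born_def)
  qed
qed

text \<open>Summing \<open>level_balance\<close> over the levels telescopes.\<close>

lemma tree_balance:
  assumes x: "x \<in> X" and "k \<le> n"
  defines "s \<equiv> \<lambda>l v. if v \<in> R l \<and> e v \<in> C k x then prob (C l (e v)) else 0"
  shows "(\<Sum>a | a \<in> edges (tree k n x) \<and> fst a = v. weight (tree k n x) a) =
         (\<Sum>a | a \<in> edges (tree k n x) \<and> snd a = v. weight (tree k n x) a) + s k v - s n v"
proof -
  let ?w = "weight (tree k n x)"
  have w: "?w (a, u) = prob (C (Suc l) (e u))" if "u \<in> born k x l" for a l u
    using birth_born[OF that] by (simp add: tree_def)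
  have "(\<Sum>a | a \<in> edges (tree k n x) \<and> fst a = v. ?w a) =
      (\<Sum>l\<in>{k..<n}. \<Sum>u\<in>born k x l. if rep l (e u) = v then prob (C (Suc l) (e u)) else 0)"
    unfolding sum.inter_filter[OF finite_tree_edges] sum_tree_edges
    by (intro sum.cong refl) (auto simp: w)
  moreover have "(\<Sum>a | a \<in> edges (tree k n x) \<and> snd a = v. ?w a) =
      (\<Sum>l\<in>{k..<n}. \<Sum>u\<in>born k x l. if u = v then prob (C (Suc l) (e u)) else 0)"
    unfolding sum.inter_filter[OF finite_tree_edges] sum_tree_edges
    by (intro sum.cong refl) (auto simp: w)
  ultimately have "(\<Sum>a | a \<in> edges (tree k n x) \<and> fst a = v. ?w a) - (\<Sum>a | a \<in> edges (tree k n x) \<and> snd a = v. ?w a)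
    = (\<Sum>l\<in>{k..<n}. (\<Sum>u\<in>born k x l. if rep l (e u) = v then prob (C (Suc l) (e u)) else 0)
       - (\<Sum>u\<in>born k x l. if u = v then prob (C (Suc l) (e u)) else 0))"
    by (simp add: sum_subtractf)
  also have "\<dots> = (\<Sum>l\<in>{k..<n}. s l v - s (Suc l) v)"
    unfolding s_def by (intro sum.cong refl level_balance[OF x]) auto
  also have "\<dots> = s k v - s n v"
    using sum_Suc_diff'[OF \<open>k \<le> n\<close>, of "\<lambda>l. - s l v"] by (simp add: algebra_simps)
  finally show ?thesis by simp
qed

lemma atoms_portion: "x \<in> X \<Longrightarrow> atoms (portion k n x) = e ` {v \<in> R n. e v \<in> C k x}"
  using atoms_approx[of n] by (auto simp: portion_def atoms_def)

lemma atomic_portion: "x \<in> X \<Longrightarrow> atomic (portion k n x)"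
  using finite_R cell_pos[OF e_in] unfolding atomic_def atoms_portion
  by (auto simp: portion_def approx_e)

lemma mass_portion:
  assumes "x \<in> X" "k \<le> n" shows "mass (portion k n x) = prob (C k x)"
proof -
  have "inj_on e {v \<in> R n. e v \<in> C k x}" by (rule inj_on_subset[OF inj_on_e]) auto
  then show ?thesis
    unfolding mass_def atoms_portion[OF assms(1)] prob_cell_eq_sum[OF assms]
    by (subst sum.reindex) (auto intro!: sum.cong simp: portion_def approx_e)
qed

text \<open>The tree meets the requirements for both signs of \<alpha>: indices strictly increase
  along edges, which excludes cycles, and \<open>e\<close> is injective on the vertices.\<close>

lemma tree_in_Path:
  assumes v0: "v0 \<in> R k" and "k \<le> n"
  shows "tree k n (e v0) \<in> Path \<alpha> (point_mass (approx k (e v0)) (e v0)) (portion k n (e v0))"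
proof -
  let ?x = "e v0" let ?G = "tree k n ?x" let ?V = "{v \<in> R n. e v \<in> C k ?x}"
  have pm: "atoms (point_mass (approx k ?x) ?x) = {?x}"
    using cell_pos[OF e_in, of k v0] v0 by (intro atoms_point_mass) (auto simp: approx_e)
  define t where "t = inv_into (R n) e"
  have t: "t (e v) = v" if "v \<in> R n" for v
    unfolding t_def by (rule inv_into_f_f[OF inj_on_e that])
  have v0V: "v0 \<in> ?V" using R_mono[OF \<open>k \<le> n\<close>] v0 cell_refl[OF e_in] by auto
  have edge: "\<exists>l u. a = (rep l (e u), u) \<and> k \<le> l \<and> l < n \<and> u \<in> born k ?x l"
    if "a \<in> edges ?G" for a
    using that by (auto simp: tree_def)
  have "finite (vertices ?G)" using finite_R by (simp add: tree_def)
  moreover have "edges ?G \<subseteq> vertices ?G \<times> vertices ?G"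
  proof
    fix a assume "a \<in> edges ?G"
    from edge[OF this] obtain l u where a: "a = (rep l (e u), u)" "k \<le> l" "l < n" "u \<in> born k ?x l" 
      by blast
    have "u \<in> ?V" using a R_mono[of "Suc l" n] by (auto simp: born_def)
    moreover have "rep l (e u) \<in> ?V"
      using a rep_in_R[OF e_in] R_mono[of l n] rep_in_cell[OF e_in] by (auto simp: born_def)
    ultimately show "a \<in> vertices ?G \<times> vertices ?G" using a by (simp add: tree_def)
  qed
  moreover have "\<forall>a\<in>edges ?G. weight ?G a > 0"
    using cell_pos[OF e_in] by (auto simp: tree_def)
  moreover have "acyclic (edges ?G)"
  proof (rule acyclic_subset[OF wf_acyclic[OF wf_less_than]])
    show "edges ?G \<subseteq> less_than" using edge rep_born_less by fastforce
  qed
  moreover have "\<forall>a\<in>edges ?G. pos ?G (fst a) \<noteq> pos ?G (snd a)"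
  proof
    fix a assume "a \<in> edges ?G"
    from edge[OF this] obtain l u where a: "a = (rep l (e u), u)" "u \<in> born k ?x l" 
      by blast
    \<comment> \<open>If the two points coincided, the smaller index would also represent a point of
      the cell of \<open>u\<close> in generation \<open>Suc l\<close>, against the minimality of
      \<open>u\<close>.\<close>
    have "e (rep l (e u)) \<noteq> e u"
    proof
      assume "e (rep l (e u)) = e u"
      then have "rep (Suc l) (e u) \<le> rep l (e u)"
        using rep_le[of "rep l (e u)" "Suc l" "e u"] cell_refl[OF e_in] by simp
      then show False using rep_born_less[OF a(2)] a(2) by (auto simp: born_def R_def)
    qed
    then show "pos ?G (fst a) \<noteq> pos ?G (snd a)" using a by (simp add: tree_def)
  qed
  moreover have "inj_on (pos ?G) (vertices ?G)"
    by (simp add: tree_def) (rule inj_on_subset[OF inj_on_e], auto)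
  moreover have "\<exists>s t.
        (\<forall>x\<in>atoms (point_mass (approx k ?x) ?x). s x \<in> vertices ?G \<and> pos ?G (s x) = x) \<and>
        (\<forall>y\<in>atoms (portion k n ?x). t y \<in> vertices ?G \<and> pos ?G (t y) = y) \<and>
        (\<forall>v\<in>vertices ?G.
           (\<Sum>a | a \<in> edges ?G \<and> fst a = v. weight ?G a) =
           (\<Sum>a | a \<in> edges ?G \<and> snd a = v. weight ?G a)
           + (\<Sum>y | y \<in> atoms (point_mass (approx k ?x) ?x) \<and> s y = v. point_mass (approx k ?x) ?x y)
           - (\<Sum>y | y \<in> atoms (portion k n ?x) \<and> t y = v. portion k n ?x y))"
  proof (intro exI conjI ballI)
    fix y assume "y \<in> atoms (point_mass (approx k ?x) ?x)"
    then have "y = ?x" by (simp add: pm)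
    then show "(\<lambda>_. v0) y \<in> vertices ?G" "pos ?G ((\<lambda>_. v0) y) = y" using v0V by (simp_all add: tree_def)
  next
    fix y assume "y \<in> atoms (portion k n ?x)"
    then obtain v where "y = e v" "v \<in> ?V" unfolding atoms_portion[OF e_in] by blast
    then show "t y \<in> vertices ?G" "pos ?G (t y) = y" using t by (simp_all add: tree_def)
  next
    fix v assume "v \<in> vertices ?G"
    then have v: "v \<in> ?V" by (simp add: tree_def)
    have "{y. y \<in> atoms (point_mass (approx k ?x) ?x) \<and> v0 = v} = (if v = v0 then {?x} else {})"
      by (auto simp: pm)
    \<comment> \<open>\<open>v0\<close> is the only representative of generation \<open>k\<close> in
      its own cell, so the source term has the form required by \<open>tree_balance\<close>.\<close>
    then have src: "(\<Sum>y | y \<in> atoms (point_mass (approx k ?x) ?x) \<and> v0 = v. point_mass (approx k ?x) ?x y)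
      = (if v \<in> R k \<and> e v \<in> C k ?x then prob (C k (e v)) else 0)"
      using R_eqI[of v k v0] v0 cell_refl[OF e_in] by (auto simp: point_mass_def approx_e)
    have "{y. y \<in> atoms (portion k n ?x) \<and> t y = v} = {e v}"
      using v t by (auto simp: atoms_portion[OF e_in])
    then have snk: "(\<Sum>y | y \<in> atoms (portion k n ?x) \<and> t y = v. portion k n ?x y)
      = (if v \<in> R n \<and> e v \<in> C k ?x then prob (C n (e v)) else 0)"
      using v by (auto simp: portion_def approx_e)
    show "(\<Sum>a | a \<in> edges ?G \<and> fst a = v. weight ?G a) =
           (\<Sum>a | a \<in> edges ?G \<and> snd a = v. weight ?G a)
           + (\<Sum>y | y \<in> atoms (point_mass (approx k ?x) ?x) \<and> (\<lambda>_. v0) y = v. point_mass (approx k ?x) ?x y)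
           - (\<Sum>y | y \<in> atoms (portion k n ?x) \<and> t y = v. portion k n ?x y)"
      unfolding src snk by (rule tree_balance[OF e_in \<open>k \<le> n\<close>])
  qed
  ultimately show ?thesis unfolding Path_def by simp
qed

text \<open>An edge of level \<open>l\<close> joins two points of one cell of generation
  \<open>l\<close>, so its length is at most \<open>D l\<close>. The cells of generation
  \<open>k\<close> split the indices born at level \<open>l\<close> among their trees without
  overlap.\<close>

lemma sum_cost_tree_le:
  assumes "k \<le> n"
  shows "(\<Sum>x\<in>e ` R k. M_cost \<alpha> (tree k n x)) \<le>
    (\<Sum>l\<in>{k..<n}. (\<Sum>u\<in>R (Suc l) - R l. prob (C (Suc l) (e u)) powr \<alpha>) * D l)"
proof -
  have "M_cost \<alpha> (tree k n (e v)) \<le> (\<Sum>l\<in>{k..<n}. \<Sum>u\<in>born k (e v) l. prob (C (Suc l) (e u)) powr \<alpha> * D l)"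
    for v
    unfolding M_cost_def sum_tree_edges
  proof (intro sum_mono)
    fix l u assume u: "u \<in> born k (e v) l"
    have "dist (e (rep l (e u))) (e u) \<le> D l"
      using cell_diam[OF e_in e_rep[OF e_in]] by (simp add: dist_commute)
    then show "weight (tree k n (e v)) (rep l (e u), u) powr \<alpha> *
        dist (pos (tree k n (e v)) (fst (rep l (e u), u))) (pos (tree k n (e v)) (snd (rep l (e u), u)))
        \<le> prob (C (Suc l) (e u)) powr \<alpha> * D l"
      using birth_born[OF u] by (simp add: tree_def mult_left_mono)
  qed
  then have "(\<Sum>x\<in>e ` R k. M_cost \<alpha> (tree k n x)) \<le>
      (\<Sum>v\<in>R k. \<Sum>l\<in>{k..<n}. \<Sum>u\<in>born k (e v) l. prob (C (Suc l) (e u)) powr \<alpha> * D l)"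
    unfolding sum.reindex[OF inj_on_e] o_def by (intro sum_mono)
  also have "\<dots> = (\<Sum>l\<in>{k..<n}. \<Sum>v\<in>R k. \<Sum>u\<in>born k (e v) l. prob (C (Suc l) (e u)) powr \<alpha> * D l)"
    by (rule sum.swap)
  also have "\<dots> = (\<Sum>l\<in>{k..<n}. (\<Sum>u\<in>R (Suc l) - R l. prob (C (Suc l) (e u)) powr \<alpha>) * D l)"
  proof (intro sum.cong refl)
    fix l
    have "(\<Union>v\<in>R k. born k (e v) l) = R (Suc l) - R l"
      using rep_in_R[OF e_in, of k] cell_sym[OF e_in e_rep[OF e_in]] by (fastforce simp: born_def)
    moreover have "(\<Sum>u\<in>(\<Union>v\<in>R k. born k (e v) l). prob (C (Suc l) (e u)) powr \<alpha> * D l) =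
       (\<Sum>v\<in>R k. \<Sum>u\<in>born k (e v) l. prob (C (Suc l) (e u)) powr \<alpha> * D l)"
      using finite_R finite_born disjoint_cells[of k]
      by (intro sum.UNION_disjoint) (auto simp: born_def disjoint_family_on_def)
    ultimately show "(\<Sum>v\<in>R k. \<Sum>u\<in>born k (e v) l. prob (C (Suc l) (e u)) powr \<alpha> * D l) =
      (\<Sum>u\<in>R (Suc l) - R l. prob (C (Suc l) (e u)) powr \<alpha>) * D l"
      by (simp add: sum_distrib_right)
  qed
  finally show ?thesis .
qed

text \<open>The cost from generation \<open>k\<close> to \<open>n\<close> is at most a block of a
  convergent series, so the Cauchy criterion provides the threshold for admissibility.\<close>

lemma in_D_class:
  assumes "summable (\<lambda>l. (\<Sum>u\<in>R (Suc l) - R l. prob (C (Suc l) (e u)) powr \<alpha>) * D l)"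
    (is "summable ?c")
  shows "\<mu> \<in> D_class \<alpha>"
proof -
  have "admissible_Cauchy \<alpha> approx"
    unfolding admissible_Cauchy_def
  proof (intro conjI allI impI)
    fix \<epsilon> :: real assume "\<epsilon> > 0"
    then obtain N where N: "\<And>k n. k \<ge> N \<Longrightarrow> norm (sum ?c {k..<n}) < \<epsilon>"
      using assms[unfolded summable_Cauchy] by blast
    show "\<exists>N. \<forall>k\<ge>N. \<forall>n>k. \<exists>(p :: 'a \<Rightarrow> 'a \<Rightarrow> real) (G :: 'a \<Rightarrow> 'a transport_graph).
          (\<forall>x\<in>atoms (approx k). atomic (p x) \<and> mass (p x) = approx k x) \<and>
          disjoint_family_on (\<lambda>x. atoms (p x)) (atoms (approx k)) \<and>
          (\<forall>z. approx n z = (\<Sum>x\<in>atoms (approx k). p x z)) \<and>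
          (\<forall>x\<in>atoms (approx k). G x \<in> Path \<alpha> (point_mass (approx k x) x) (p x)) \<and>
          (\<Sum>x\<in>atoms (approx k). M_cost \<alpha> (G x)) \<le> \<epsilon>"
    proof (rule exI[of _ N], intro allI impI, rule exI[of _ "portion k n" for k n], rule exI[of _ "tree k n" for k n], intro conjI)
      fix k n assume kn: "k \<ge> N" "n > k"
      show "\<forall>x\<in>atoms (approx k). atomic (portion k n x) \<and> mass (portion k n x) = approx k x"
        unfolding atoms_approx using kn by (auto simp: atomic_portion mass_portion e_in approx_e)
      show "disjoint_family_on (\<lambda>x. atoms (portion k n x)) (atoms (approx k))"
        unfolding disjoint_family_on_def
      proof (intro ballI impI)
        fix x y assume xy: "x \<in> atoms (approx k)" "y \<in> atoms (approx k)" "x \<noteq> y"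
        then obtain u v where uv: "x = e u" "y = e v" "u \<in> R k" "v \<in> R k" "u \<noteq> v"
          by (auto simp: atoms_approx)
        then have "C k x \<inter> C k y = {}" using disjoint_cells[of k] by (auto simp: disjoint_family_on_def)
        then show "atoms (portion k n x) \<inter> atoms (portion k n y) = {}"
          using uv by (auto simp: atoms_portion e_in)
      qed
      show "\<forall>z. approx n z = (\<Sum>x\<in>atoms (approx k). portion k n x z)"
      proof
        fix z
        show "approx n z = (\<Sum>x\<in>atoms (approx k). portion k n x z)"
        proof (cases "z \<in> e ` R n")
          case True
          then have z: "z \<in> X" by (auto simp: e_in)
          have "(\<Sum>x\<in>atoms (approx k). portion k n x z) = (\<Sum>v\<in>R k. if v = rep k z then approx n z else 0)"
            unfolding atoms_approx sum.reindex[OF inj_on_e] o_def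
            using rep_eq_iff[OF _ z, of _ k] by (intro sum.cong) (auto simp: portion_def)
          also have "\<dots> = approx n z" using finite_R rep_in_R[OF z] by (subst sum.delta) auto
          finally show ?thesis ..
        next
          case False
          then have "approx n z = 0" "portion k n x z = 0" for x by (auto simp: approx_def portion_def)
          then show ?thesis by simp
        qed
      qed
      show "\<forall>x\<in>atoms (approx k). tree k n x \<in> Path \<alpha> (point_mass (approx k x) x) (portion k n x)"
        unfolding atoms_approx using kn by (auto intro!: tree_in_Path)
      have "(\<Sum>x\<in>atoms (approx k). M_cost \<alpha> (tree k n x)) \<le> sum ?c {k..<n}"
        unfolding atoms_approx using kn by (intro sum_cost_tree_le) auto
      then show "(\<Sum>x\<in>atoms (approx k). M_cost \<alpha> (tree k n x)) \<le> \<epsilon>"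
        using N[OF kn(1), of n] by (simp only: real_norm_def)
    qed
  qed (simp_all add: atomic_approx mass_approx)
  then show ?thesis
    unfolding D_class_def using sets_eq mass_approx weakly_converges_approx prob_space_axioms by blast
qed

end


section \<open>Nested collections\<close>

locale nested_measure = prob_space \<mu> for \<mu> :: "'a::metric_space measure" +
  fixes \<sigma> :: real and N :: "nat \<Rightarrow> nat" and Q :: "nat \<Rightarrow> nat \<Rightarrow> 'a set" and K :: real
  assumes sets_borel: "sets \<mu> = sets borel"
    and nested: "nested_collection \<sigma> N Q"
    and concentrated: "concentrated_on \<mu> N Q"
    and diam: "\<And>n i. n \<ge> 1 \<Longrightarrow> i \<in> {1..N n} \<Longrightarrow> bounded (Q n i) \<and> diameter (Q n i) \<le> K * \<sigma> ^ n"
begin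

text \<open>Cubes start at generation 1 and cells at generation 0, hence the shift by one.\<close>

definition J :: "nat \<Rightarrow> nat set" where
  "J n = {i \<in> {1..N (Suc n)}. prob (Q (Suc n) i) > 0}"

text \<open>Null cubes are left out because every cell must carry positive mass; altogether this
  discards only countably many null sets.\<close>

definition full :: "'a set" where
  "full = (\<Inter>n. \<Union>i\<in>J n. Q (Suc n) i)"

text \<open>For \<open>z\<close> in \<open>full\<close> the union has a single member, by
  \<open>Q_unique\<close>; writing it as a union avoids choosing an index.\<close>

definition cell :: "nat \<Rightarrow> 'a \<Rightarrow> 'a set" where
  "cell n z = full \<inter> (\<Union>i\<in>{i \<in> J n. z \<in> Q (Suc n) i}. Q (Suc n) i)"

lemma \<sigma>: "0 < \<sigma>" "\<sigma> < 1"
  using nested by (auto simp: nested_collection_def)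

lemma Q_events: "n \<ge> 1 \<Longrightarrow> i \<in> {1..N n} \<Longrightarrow> Q n i \<in> events"
  using nested by (simp add: nested_collection_def sets_borel)

lemma Q_cases:
  assumes "l \<ge> 1" "k \<ge> l" "i \<in> {1..N k}" "j \<in> {1..N l}" "z \<in> Q k i" "z \<in> Q l j"
  shows "Q k i \<subseteq> Q l j"
proof -
  have *: "\<forall>l\<ge>1. \<forall>k\<ge>l. \<forall>i\<in>{1..N k}. \<forall>j\<in>{1..N l}. Q k i \<inter> Q l j = {} \<or> Q k i \<subseteq> Q l j"
    using nested unfolding nested_collection_def by (elim conjE)
  have "Q k i \<inter> Q l j = {} \<or> Q k i \<subseteq> Q l j"
    by (rule *[rule_format, OF assms(1-4)])
  then show ?thesis using assms(5,6) by blast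
qed

lemma Q_parent: "n \<ge> 1 \<Longrightarrow> j \<in> {1..N (Suc n)} \<Longrightarrow> \<exists>!i. i \<in> {1..N n} \<and> Q (Suc n) j \<subseteq> Q n i"
  using nested unfolding nested_collection_def by (elim conjE) simp

lemma Q_child: "n \<ge> 1 \<Longrightarrow> i \<in> {1..N n} \<Longrightarrow> \<exists>j\<in>{1..N (Suc n)}. Q (Suc n) j \<subseteq> Q n i"
  using nested unfolding nested_collection_def by (elim conjE) simp

text \<open>Two cubes of one generation that meet are equal as sets, and then a child has only one parent.\<close>

lemma Q_unique:
  assumes n: "n \<ge> 1" and ij: "i \<in> {1..N n}" "j \<in> {1..N n}" and z: "z \<in> Q n i" "z \<in> Q n j"
  shows "i = j"
proof -
  have "Q n i \<subseteq> Q n j" by (rule Q_cases[OF n order_refl ij z])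
  moreover obtain c where c: "c \<in> {1..N (Suc n)}" "Q (Suc n) c \<subseteq> Q n i"
    using Q_child[OF n ij(1)] by blast
  ultimately show ?thesis using Q_parent[OF n c(1)] ij by blast
qed

lemma finite_J: "finite (J n)" by (simp add: J_def)

lemma J_events: "i \<in> J n \<Longrightarrow> Q (Suc n) i \<in> events"
  by (rule Q_events) (auto simp: J_def)

lemma full_events: "full \<in> events"
  unfolding full_def using J_events finite_J by (intro sets.countable_INT' sets.finite_UN) auto

lemma AE_level: "AE z in \<mu>. z \<in> (\<Union>i\<in>J n. Q (Suc n) i)"
proof -
  have ev: "(\<Union>i\<in>{1..N (Suc n)}. Q (Suc n) i) \<in> events"
    using Q_events by (intro sets.finite_UN) auto
  have "space \<mu> - (\<Union>i\<in>{1..N (Suc n)}. Q (Suc n) i) \<in> null_sets \<mu>"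
    using concentrated ev by (auto simp: concentrated_on_def null_sets_def)
  then have 1: "AE z in \<mu>. z \<notin> space \<mu> - (\<Union>i\<in>{1..N (Suc n)}. Q (Suc n) i)" by (rule AE_not_in)
  have "Q (Suc n) i \<in> null_sets \<mu>" if "i \<in> {1..N (Suc n)} - J n" for i
  proof -
    have "prob (Q (Suc n) i) = 0" using that measure_nonneg[of \<mu> "Q (Suc n) i"] by (auto simp: J_def less_le)
    then show ?thesis using Q_events[of "Suc n" i] that by (auto simp: emeasure_eq_measure)
  qed
  then have "(\<Union>i\<in>{1..N (Suc n)} - J n. Q (Suc n) i) \<in> null_sets \<mu>" by (intro null_sets.finite_UN) auto
  then have 2: "AE z in \<mu>. z \<notin> (\<Union>i\<in>{1..N (Suc n)} - J n. Q (Suc n) i)" by (rule AE_not_in)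
  show ?thesis using 1 2 AE_space by eventually_elim blast
qed

lemma AE_full: "AE z in \<mu>. z \<in> full"
  using AE_level by (simp add: full_def AE_all_countable)

lemma prob_full: "prob full = 1"
  using AE_full full_events by (subst prob_eq_1) auto

lemma prob_full_Int: "A \<in> events \<Longrightarrow> prob (full \<inter> A) = prob A"
  using AE_full full_events by (intro finite_measure_eq_AE) auto

lemma in_full: "z \<in> full \<Longrightarrow> \<exists>i\<in>J n. z \<in> Q (Suc n) i"
  by (auto simp: full_def)

lemma cell_eq_Q:
  assumes "i \<in> J n" "z \<in> Q (Suc n) i"
  shows "cell n z = full \<inter> Q (Suc n) i"
proof -
  have "{j \<in> J n. z \<in> Q (Suc n) j} = {i}"
    using assms Q_unique[of "Suc n" _ i z] by (auto simp: J_def)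
  then show ?thesis by (simp add: cell_def)
qed

lemma Q_nonempty: "i \<in> J n \<Longrightarrow> full \<inter> Q (Suc n) i \<noteq> {}"
  using prob_full_Int[OF J_events, of i n] by (auto simp: J_def)

text \<open>Enumerates one point in every cube of positive mass through codes of pairs; the
  remaining codes give arbitrary points of \<open>full\<close>.\<close>

definition pt :: "nat \<Rightarrow> 'a" where
  "pt m = (case prod_decode m of (n, i) \<Rightarrow> SOME z. z \<in> full \<and> (i \<in> J n \<longrightarrow> z \<in> Q (Suc n) i))"

lemma pt: "pt (prod_encode (n, i)) \<in> full \<and> (i \<in> J n \<longrightarrow> pt (prod_encode (n, i)) \<in> Q (Suc n) i)"
proof -
  have "full \<noteq> {}" using prob_full by auto
  then have "\<exists>z. z \<in> full \<and> (i \<in> J n \<longrightarrow> z \<in> Q (Suc n) i)" using Q_nonempty by blast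
  from someI_ex[OF this] show ?thesis by (simp add: pt_def)
qed

lemma pt_full: "pt m \<in> full"
  using pt[of "fst (prod_decode m)" "snd (prod_decode m)"] by simp

lemma cells_subset: "cell n ` full \<subseteq> (\<lambda>i. full \<inter> Q (Suc n) i) ` J n"
  using in_full cell_eq_Q by blast

lemma card_cells: "card (cell n ` full) \<le> N (Suc n)"
proof -
  have "card (cell n ` full) \<le> card ((\<lambda>i. full \<inter> Q (Suc n) i) ` J n)"
    by (intro card_mono cells_subset finite_imageI finite_J)
  also have "\<dots> \<le> card (J n)" by (rule card_image_le[OF finite_J])
  also have "\<dots> \<le> card {1..N (Suc n)}" by (intro card_mono) (auto simp: J_def)
  finally show ?thesis by simp
qed

sublocale refining_partition \<mu> full cell pt "\<lambda>n. K * \<sigma> ^ Suc n"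
proof
  fix n z assume z: "z \<in> full"
  then obtain i where i: "i \<in> J n" "z \<in> Q (Suc n) i" using in_full by blast
  note c = cell_eq_Q[OF i]
  show "z \<in> cell n z" using z i c by simp
  show "cell n z \<subseteq> full" using c by simp
  show "cell n z \<in> events" unfolding c using full_events J_events[OF i(1)] by auto
  show "prob (cell n z) > 0" unfolding c prob_full_Int[OF J_events[OF i(1)]] using i by (simp add: J_def)
  have "full \<inter> Q (Suc n) i \<noteq> {}" using z i by blast
  have "pt (prod_encode (n, i)) \<in> cell n z" using pt[of n i] i(1) unfolding c by blast
  then show "\<exists>m. pt m \<in> cell n z" by blast
  show "cell (Suc n) z \<subseteq> cell n z"
  proof -
    obtain j where j: "j \<in> J (Suc n)" "z \<in> Q (Suc (Suc n)) j" using in_full[OF z] by blast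
    have "Q (Suc (Suc n)) j \<subseteq> Q (Suc n) i"
      by (rule Q_cases[OF _ _ _ _ j(2) i(2)]) (use i j in \<open>auto simp: J_def\<close>)
    then show ?thesis unfolding c cell_eq_Q[OF j] by blast
  qed
  fix z' assume "z' \<in> cell n z"
  then have z': "z' \<in> full" "z' \<in> Q (Suc n) i" unfolding c by auto
  show "cell n z' = cell n z" unfolding c cell_eq_Q[OF i(1) z'(2)] ..
  have "i \<in> {1..N (Suc n)}" using i by (simp add: J_def)
  then have "dist z z' \<le> diameter (Q (Suc n) i)" "diameter (Q (Suc n) i) \<le> K * \<sigma> ^ Suc n"
    using diam[of "Suc n" i] i z' by (auto intro!: diameter_bounded_bound)
  then show "dist z z' \<le> K * \<sigma> ^ Suc n" by linarith
next
  show "finite (cell n ` full)" for n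
    by (rule finite_subset[OF cells_subset finite_imageI[OF finite_J]])
  show "(\<lambda>n. K * \<sigma> ^ Suc n) \<longlonglongrightarrow> 0"
    using \<sigma> by (intro tendsto_mult_right_zero LIMSEQ_Suc LIMSEQ_power_zero) auto
qed (rule sets_borel full_events prob_full pt_full)+

lemma card_R_le_N: "card (R n) \<le> N (Suc n)"
  using card_R_le card_cells le_trans by blast

text \<open>A new index \<open>u\<close> and the representative \<open>v\<close> that feeds it lie
  in two different cubes of generation \<open>l + 2\<close> inside one cube of generation
  \<open>l + 1\<close>. The cube of \<open>u\<close> thus has a brother, and even concentration
  bounds its mass from below.\<close>

lemma prob_new_cell_ge:
  assumes even: "\<forall>n\<ge>1. \<forall>i\<in>{1..N n}. (\<nexists>j. brothers N Q n i j) \<or> prob (Q n i) \<ge> c / real (N n)"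
    and u: "u \<in> R (Suc l) - R l"
  shows "prob (cell (Suc l) (pt u)) \<ge> c / real (N (Suc (Suc l)))"
proof -
  obtain i where i: "i \<in> J (Suc l)" "pt u \<in> Q (Suc (Suc l)) i" using in_full[OF pt_full] by blast
  obtain p where p: "p \<in> J l" "pt u \<in> Q (Suc l) p" using in_full[OF pt_full] by blast
  define v where "v = rep l (pt u)"
  obtain j where j: "j \<in> J (Suc l)" "pt v \<in> Q (Suc (Suc l)) j" using in_full[OF pt_full] by blast
  have v: "pt v \<in> Q (Suc l) p"
    using e_rep[OF pt_full, of l u] cell_eq_Q[OF p] by (auto simp: v_def)
  have "v < u" using u rep_le[OF cell_refl[OF pt_full], of l u] by (auto simp: v_def R_def)
  \<comment> \<open>In a common cube the smaller index \<open>v\<close> would replace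
    \<open>u\<close> as the representative.\<close>
  have "i \<noteq> j"
  proof
    assume "i = j"
    then have "pt v \<in> cell (Suc l) (pt u)" using cell_eq_Q[OF i] j pt_full by auto
    then have "rep (Suc l) (pt u) \<le> v" by (rule rep_le)
    then show False using u \<open>v < u\<close> by (simp add: R_def)
  qed
  moreover have "Q (Suc (Suc l)) i \<subseteq> Q (Suc l) p" 
    by (rule Q_cases[OF _ _ _ _ i(2) p(2)]) (use i p in \<open>auto simp: J_def\<close>)
  moreover have "Q (Suc (Suc l)) j \<subseteq> Q (Suc l) p" 
    by (rule Q_cases[OF _ _ _ _ j(2) v]) (use j p in \<open>auto simp: J_def\<close>)
  ultimately have "brothers N Q (Suc (Suc l)) i j"
    using i(1) j(1) p(1) by (auto simp: brothers_def J_def)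
  then have "prob (Q (Suc (Suc l)) i) \<ge> c / real (N (Suc (Suc l)))"
    using even i(1) by (force simp: J_def)
  then show ?thesis unfolding cell_eq_Q[OF i] prob_full_Int[OF J_events[OF i(1)]] .
qed

end

section \<open>Cost per generation and summability\<close>

lemma sum_powr_le:
  fixes w :: "'b \<Rightarrow> real"
  assumes "finite A" "card A \<le> n" and w: "\<And>u. u \<in> A \<Longrightarrow> 0 < w u" and "sum w A \<le> 1" and "0 \<le> \<alpha>" "\<alpha> < 1"
  shows "(\<Sum>u\<in>A. w u powr \<alpha>) \<le> 2 * real n powr (1 - \<alpha>)"
proof (cases "n = 0")
  case True
  then show ?thesis using assms by simp
next
  case False
  then have n: "real n > 0" by simp
  \<comment> \<open>The two summands bound the weights below and above the threshold
    \<open>1 / n\<close>. Summed with at most \<open>n\<close> weights of total at most 1, each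
    gives \<open>n powr (1 - \<alpha>)\<close>, hence the factor 2.\<close>
  have "(\<Sum>u\<in>A. w u powr \<alpha>) \<le> (\<Sum>u\<in>A. real n powr - \<alpha> + w u * real n powr (1 - \<alpha>))"
  proof (rule sum_mono)
    fix u assume u: "u \<in> A"
    show "w u powr \<alpha> \<le> real n powr - \<alpha> + w u * real n powr (1 - \<alpha>)"
    proof (cases "w u \<le> 1 / real n")
      case True
      have "w u powr \<alpha> \<le> (1 / real n) powr \<alpha>"
        using True w[OF u] \<open>0 \<le> \<alpha>\<close> by (intro powr_mono2) auto
      also have "\<dots> = real n powr - \<alpha>" using n by (simp add: powr_divide powr_minus_divide)
      finally show ?thesis using w[OF u] by (simp add: add_increasing2)
    next
      case False
      have "w u powr \<alpha> = w u * w u powr (\<alpha> - 1)" using w[OF u] by (simp add: powr_diff)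
      also have "\<dots> \<le> w u * (1 / real n) powr (\<alpha> - 1)"
        using False w[OF u] n \<open>\<alpha> < 1\<close> by (intro mult_left_mono powr_mono2') auto
      also have "(1 / real n) powr (\<alpha> - 1) = real n powr (1 - \<alpha>)"
        using n powr_minus_divide[of "real n" "\<alpha> - 1"] by (simp add: powr_divide)
      finally show ?thesis by (simp add: add_increasing)
    qed
  qed
  also have "\<dots> = real (card A) * real n powr - \<alpha> + sum w A * real n powr (1 - \<alpha>)"
    by (simp add: sum.distrib sum_distrib_right)
  also have "\<dots> \<le> real n * real n powr - \<alpha> + 1 * real n powr (1 - \<alpha>)"
    using assms(2,4) by (intro add_mono mult_right_mono) auto
  also have "real n * real n powr - \<alpha> = real n powr (1 - \<alpha>)"
    using n by (simp add: powr_diff powr_minus_divide)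
  finally show ?thesis by simp
qed

text \<open>The limit only controls \<open>ln (N n)\<close> up to an error of order
  \<open>n\<close>; the gap between \<open>d\<close> and \<open>d'\<close> absorbs it and yields a
  purely geometric bound.\<close>

lemma Minkowski_dim_growth:
  assumes "has_Minkowski_dim \<sigma> N d" "0 < \<sigma>" "\<sigma> < 1" "d < d'" "\<beta> \<ge> 0"
  shows "eventually (\<lambda>n. real (N n) powr \<beta> \<le> (\<sigma> powr - (d' * \<beta>)) ^ n) sequentially"
proof -
  have "eventually (\<lambda>n. ln (real (N n)) / ln (1 / \<sigma> ^ n) < d') sequentially"
    using assms(1,4) unfolding has_Minkowski_dim_def by (rule order_tendstoD)
  \<comment> \<open>For \<open>n = 0\<close> the denominator \<open>ln (1 / \<sigma> ^ n)\<close> is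
    0, so the quotient says nothing about \<open>N n\<close>.\<close>
  then show ?thesis using eventually_gt_at_top[of 0]
  proof eventually_elim
    case (elim n)
    show ?case
    proof (cases "N n = 0")
      case False
      have L: "ln (1 / \<sigma> ^ n) = - real n * ln \<sigma>" using assms by (simp add: ln_div ln_realpow)
      have "ln (1 / \<sigma> ^ n) > 0" unfolding L using assms elim by (simp add: mult_pos_neg)
      then have "ln (real (N n)) \<le> d' * ln (1 / \<sigma> ^ n)" using elim by (simp add: field_simps)
      then have "\<beta> * ln (real (N n)) \<le> \<beta> * (d' * (- real n * ln \<sigma>))"
        unfolding L using assms by (intro mult_left_mono) auto
      then have "real (N n) powr \<beta> \<le> exp (real n * (- (d' * \<beta>) * ln \<sigma>))"
        using False by (simp add: powr_def mult_ac)
      also have "\<dots> = (\<sigma> powr - (d' * \<beta>)) ^ n"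
        using assms exp_of_nat_mult[of n "- (d' * \<beta>) * ln \<sigma>"] by (simp add: powr_def)
      finally show ?thesis .
    qed (use assms in simp)
  qed
qed

text \<open>The condition on \<alpha> leaves room for some \<open>d' > d\<close> with
  \<open>(1 - \<alpha>) * d' < 1\<close>. The number of cubes then grows slowly enough for the
  shrinking diameters to make the cost per level geometric with ratio \<open>q < 1\<close>.\<close>

lemma D_class_of_nested_collection:
  fixes \<mu> :: "'a::metric_space measure"
  assumes prob: "prob_space \<mu>" and sets: "sets \<mu> = sets borel"
    and nest: "nested_collection \<sigma> N Q" and conc: "concentrated_on \<mu> N Q" and dim: "has_Minkowski_dim \<sigma> N d"
    and \<alpha>: "\<alpha> < 1" "(1 - \<alpha>) * d < 1" and cases: "0 \<le> \<alpha> \<or> evenly_concentrated_on \<mu> N Q"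
  shows "\<mu> \<in> D_class \<alpha>"
proof -
  interpret prob_space \<mu> by (rule prob)
  obtain K where K: "\<forall>n\<ge>1. \<forall>i\<in>{1..N n}. bounded (Q n i) \<and> diameter (Q n i) \<le> K * \<sigma> ^ n" "K > 0"
  proof -
    have "\<exists>C1 C2. 0 < C1 \<and> C1 \<le> C2 \<and> (\<forall>n\<ge>1. \<forall>i\<in>{1..N n}. bounded (Q n i) \<and>
           C1 * \<sigma> ^ n \<le> diameter (Q n i) \<and> diameter (Q n i) \<le> C2 * \<sigma> ^ n)"
      using nest unfolding nested_collection_def by (elim conjE)
    then obtain C1 C2 where "0 < C1" "C1 \<le> C2" "\<forall>n\<ge>1. \<forall>i\<in>{1..N n}. bounded (Q n i) \<and>
           C1 * \<sigma> ^ n \<le> diameter (Q n i) \<and> diameter (Q n i) \<le> C2 * \<sigma> ^ n"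
      by (elim exE conjE)
    then show thesis by (intro that[of C2]) auto
  qed
  interpret nested_measure \<mu> \<sigma> N Q K
    by standard (use sets nest conc K in auto)
  define S where "S l = (\<Sum>u\<in>R (Suc l) - R l. prob (cell (Suc l) (pt u)) powr \<alpha>)" for l
  have card: "card (R (Suc l) - R l) \<le> N (Suc (Suc l))" for l
    using card_R_le_N[of "Suc l"] card_mono[OF finite_R, of "R (Suc l) - R l" "Suc l"] by auto
  obtain B where B: "\<And>l. S l \<le> B * real (N (Suc (Suc l))) powr (1 - \<alpha>)" "B \<ge> 0"
  proof (cases "\<alpha> \<ge> 0")
    case True
    have "S l \<le> 2 * real (N (Suc (Suc l))) powr (1 - \<alpha>)" for l
      unfolding S_def
    proof (rule sum_powr_le[OF _ card _ _ True \<alpha>(1)])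
      have "(\<Sum>u\<in>R (Suc l) - R l. prob (cell (Suc l) (pt u))) \<le> (\<Sum>u\<in>R (Suc l). prob (cell (Suc l) (pt u)))"
        using finite_R by (intro sum_mono2) auto
      then show "(\<Sum>u\<in>R (Suc l) - R l. prob (cell (Suc l) (pt u))) \<le> 1" by (simp add: sum_prob_cells)
    qed (use finite_R cell_pos[OF pt_full] in auto)
    then show thesis using that[of 2] by simp
  next
    case False
    then obtain c where c: "c > 0" and even:
      "\<forall>n\<ge>1. \<forall>i\<in>{1..N n}. (\<nexists>j. brothers N Q n i j) \<or> prob (Q n i) \<ge> c / real (N n)"
      using cases unfolding evenly_concentrated_on_def by blast
    have "S l \<le> c powr \<alpha> * real (N (Suc (Suc l))) powr (1 - \<alpha>)" for l
    proof (cases "N (Suc (Suc l)) = 0")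
      case True
      then have "R (Suc l) - R l = {}" using card[of l] finite_R[of "Suc l"] by simp
      then show ?thesis unfolding S_def by (simp only: sum.empty) simp
    next
      case Npos: False
      let ?n = "real (N (Suc (Suc l)))"
      \<comment> \<open>For negative \<alpha> the power is decreasing, so the lower bound on the
        mass of new cells bounds every term from above.\<close>
      have "S l \<le> (\<Sum>u\<in>R (Suc l) - R l. (c / ?n) powr \<alpha>)"
        unfolding S_def using prob_new_cell_ge[OF even] False c Npos
        by (intro sum_mono powr_mono2') auto
      also have "\<dots> \<le> ?n * (c / ?n) powr \<alpha>"
        using card[of l] by (simp add: mult_right_mono)
      also have "\<dots> = c powr \<alpha> * ?n powr (1 - \<alpha>)"
        using c Npos by (simp add: powr_divide powr_diff)
      finally show ?thesis .
    qed
    then show thesis using that[of "c powr \<alpha>"] by simp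
  qed
  have "d < 1 / (1 - \<alpha>)" using \<alpha> by (simp add: field_simps)
  then obtain d' where d': "d < d'" "d' < 1 / (1 - \<alpha>)" using dense by blast
  define \<theta> where "\<theta> = d' * (1 - \<alpha>)"
  have "\<theta> < 1" using d' \<alpha> by (simp add: \<theta>_def field_simps)
  define q where "q = \<sigma> powr (1 - \<theta>)"
  have q: "0 \<le> q" "q < 1" using \<sigma> \<open>\<theta> < 1\<close> powr_less_mono2[of "1 - \<theta>" \<sigma> 1] by (auto simp: q_def)
  have "eventually (\<lambda>n. real (N n) powr (1 - \<alpha>) \<le> (\<sigma> powr - \<theta>) ^ n) sequentially"
    unfolding \<theta>_def using Minkowski_dim_growth[OF dim \<sigma> d'(1)] \<alpha> by simp
  then have ev: "eventually (\<lambda>l. real (N (l + 2)) powr (1 - \<alpha>) \<le> (\<sigma> powr - \<theta>) ^ (l + 2)) sequentially"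
    by (subst eventually_sequentially_seg)
  have S0: "S l \<ge> 0" for l unfolding S_def by (intro sum_nonneg) auto
  have "summable (\<lambda>l. S l * (K * \<sigma> ^ Suc l))"
  proof (rule summable_comparison_test_ev)
    \<comment> \<open>The division by \<sigma> reconciles the exponent \<open>l + 2\<close> from the
      number of cubes with the exponent \<open>l + 1\<close> from the diameters.\<close>
    show "summable (\<lambda>l. B * K / \<sigma> * q ^ (l + 2))"
      using q by (intro summable_mult summable_ignore_initial_segment summable_geometric) auto
    show "eventually (\<lambda>l. norm (S l * (K * \<sigma> ^ Suc l)) \<le> B * K / \<sigma> * q ^ (l + 2)) sequentially"
      using ev
    proof eventually_elim
      case (elim l)
      have "S l \<le> B * real (N (l + 2)) powr (1 - \<alpha>)" using B(1)[of l] by simp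
      also have "\<dots> \<le> B * (\<sigma> powr - \<theta>) ^ (l + 2)" using elim B(2) by (rule mult_left_mono)
      finally have "S l * (K * \<sigma> ^ Suc l) \<le> B * (\<sigma> powr - \<theta>) ^ (l + 2) * (K * \<sigma> ^ Suc l)"
        using K(2) \<sigma> by (intro mult_right_mono) auto
      also have "\<dots> = B * K / \<sigma> * (\<sigma> powr - \<theta> * \<sigma>) ^ (l + 2)"
        using \<sigma> by (simp add: power_mult_distrib field_simps)
      also have "\<sigma> powr - \<theta> * \<sigma> = q"
        using \<sigma> by (simp add: q_def powr_diff powr_minus_divide)
      finally show ?case using S0[of l] K(2) \<sigma> by simp
    qed
  qed
  then show ?thesis unfolding S_def by (rule in_D_class)
qed

section \<open>Comparison of the dimensions\<close>

lemma dim_T_le_of_nested_collection: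
  fixes \<mu> :: "'a::metric_space measure"
  assumes "prob_space \<mu>" "sets \<mu> = sets borel"
    "nested_collection \<sigma> N Q" "concentrated_on \<mu> N Q" "has_Minkowski_dim \<sigma> N d"
    and "d < t" "0 < t" "1 \<le> t \<or> evenly_concentrated_on \<mu> N Q"
  shows "dim_T \<mu> \<le> ereal t"
proof -
  \<comment> \<open>This solves \<open>1 / (1 - \<alpha>) = t\<close>: then \<open>d < t\<close>
    becomes \<open>(1 - \<alpha>) * d < 1\<close>, and \<open>1 \<le> t\<close> becomes
    \<open>0 \<le> \<alpha>\<close>.\<close>
  define \<alpha> where "\<alpha> = 1 - 1 / t"
  have "\<mu> \<in> D_class \<alpha>"
    by (rule D_class_of_nested_collection[OF assms(1-5)])
       (use assms(6-8) in \<open>auto simp: \<alpha>_def field_simps\<close>)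
  moreover have "\<alpha> < 1" "t = 1 / (1 - \<alpha>)" using \<open>0 < t\<close> by (auto simp: \<alpha>_def)
  ultimately show ?thesis unfolding dim_T_def by (intro Inf_lower) blast
qed

text \<open>Ensures that \<open>d + \<epsilon>\<close> is positive and hence an admissible
  \<open>t\<close> in the bound by \<open>dim_U\<close>.\<close>

lemma Minkowski_dim_nonneg:
  assumes "has_Minkowski_dim \<sigma> N d" "0 < \<sigma>" "\<sigma> < 1"
  shows "0 \<le> d"
proof (rule LIMSEQ_le_const)
  show "(\<lambda>n. ln (real (N n)) / ln (1 / \<sigma> ^ n)) \<longlonglongrightarrow> d" using assms(1) by (simp add: has_Minkowski_dim_def)
  have "0 \<le> ln (real (N n)) / ln (1 / \<sigma> ^ n)" for n
  proof (rule divide_nonneg_nonneg)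
    show "0 \<le> ln (real (N n))" by (cases "N n = 0") auto
    show "0 \<le> ln (1 / \<sigma> ^ n)" using assms by (intro ln_ge_zero) (simp add: power_le_one)
  qed
  then show "\<exists>M. \<forall>n\<ge>M. 0 \<le> ln (real (N n)) / ln (1 / \<sigma> ^ n)" by blast
qed

lemma dim_H_le_dim_T: "dim_H \<mu> \<le> dim_T \<mu>" for \<mu> :: "'a::euclidean_space measure"
  unfolding dim_T_def by (rule Inf_greatest) (auto intro: dim_H_le_of_D_class)

text \<open>A real \<open>t\<close> above the maximum exceeds the dimension of some collection and
  corresponds to a positive \<alpha>, so the concave case applies; then \<open>t\<close> tends to
  the maximum.\<close>

lemma dim_T_le_dim_M:
  fixes \<mu> :: "'a::metric_space measure"
  assumes "prob_space \<mu>" "sets \<mu> = sets borel"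
  shows "dim_T \<mu> \<le> max (dim_M \<mu>) 1"
proof (rule dense_ge)
  fix x assume x: "max (dim_M \<mu>) 1 < x"
  show "dim_T \<mu> \<le> x"
  proof (cases x)
    case (real t)
    with x have "dim_M \<mu> < ereal t" "1 < t" by (auto simp: one_ereal_def)
    then show ?thesis
      using dim_T_le_of_nested_collection[OF assms, of _ _ _ _ t]
      unfolding dim_M_def Inf_less_iff real by auto
  qed (use x in auto)
qed

text \<open>Here \<open>t = d + \<epsilon>\<close> may be below 1, that is, \<alpha> may be
  negative; even concentration covers this case.\<close>

lemma dim_T_le_dim_U:
  fixes \<mu> :: "'a::metric_space measure"
  assumes "prob_space \<mu>" "sets \<mu> = sets borel"
  shows "dim_T \<mu> \<le> dim_U \<mu>"
  unfolding dim_U_def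
proof (rule Inf_greatest, clarify)
  fix d \<sigma> N Q
  assume nest: "nested_collection \<sigma> N Q" and even: "evenly_concentrated_on \<mu> N Q"
    and dim: "has_Minkowski_dim \<sigma> N d"
  have "0 \<le> d" using Minkowski_dim_nonneg[OF dim] nest by (simp add: nested_collection_def)
  have conc: "concentrated_on \<mu> N Q" using even by (simp add: evenly_concentrated_on_def)
  show "dim_T \<mu> \<le> ereal d"
  proof (rule ereal_le_epsilon2)
    fix \<epsilon> :: real assume "0 < \<epsilon>"
    then show "dim_T \<mu> \<le> ereal d + ereal \<epsilon>"
      using dim_T_le_of_nested_collection[OF assms nest conc dim, of "d + \<epsilon>"] even \<open>0 \<le> d\<close> by simp
  qed
qed

theorem theorem3p5p2:
  fixes \<mu> :: "(real ^ 'm) measure"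
  assumes "prob_space \<mu>" and "sets \<mu> = sets borel"
  shows "(dim_H \<mu> \<le> dim_T \<mu> \<and> dim_T \<mu> \<le> max (dim_M \<mu>) 1) \<and>
         (dim_H \<mu> \<le> dim_T \<mu> \<and> dim_T \<mu> \<le> dim_U \<mu>)"
  using dim_H_le_dim_T dim_T_le_dim_M[OF assms] dim_T_le_dim_U[OF assms] by blast

end
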